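(* Let $r>2$, let $p(z_1,z_2)=1-\frac{z_1+z_2}{r}$, and let $c_{k_1,k_2}=\frac{1}{4\pi^2}\int_0^{2\pi}\!\int_0^{2\pi}\frac{e^{-i(k_1\theta_1+k_2\theta_2)}}{|p(e^{i\theta_1},e^{i\theta_2})|^2}d\theta_1d\theta_2$. Let $k_1\ge k_2>0$ be integers and let $t\to\infty$ through the positive integers. Then: (i) if $\frac{(k_1+k_2)^2}{r^2k_1k_2}<1$, $$\lim_{t\to\infty}\sqrt t\left(\frac{r^{k_1+k_2}k_1^{k_1}k_2^{k_2}}{(k_1+k_2)^{k_1+k_2}}\right)^t c_{tk_1,tk_2}=\frac{1}{\sqrt{2\pi}}\sqrt{\frac{k_1+k_2}{k_1k_2}}\,\frac{1}{1-\frac{(k_1+k_2)^2}{r^2k_1k_2}};$$ (ii) if $\frac{(k_1+k_2)^2}{r^2k_1k_2}=1$, $$\lim_{t\to\infty}\frac{c_{tk_1,tk_2}}{\left(\frac r2-\sqrt{\frac{r^2}{4}-1}\right)^{t(k_1-k_2)}}=\frac{1}{2\sqrt{1-\frac4{r^2}}};$$ (iii) if $\frac{(k_1+k_2)^2}{r^2k_1k_2}>1$, $$\lim_{t\to\infty}\frac{c_{tk_1,tk_2}}{\left(\frac r2-\sqrt{\frac{r^2}{4}-1}\right)^{t(k_1-k_2)}}=\frac{1}{\sqrt{1-\frac4{r^2}}}.$$ In (i) the convergence is uniform on compact subsets of the region $\{r>2,\ \frac{(k_1+k_2)^2}{r^2k_1k_2}<1\}$, and in (iii) it is uniform on compact subsets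 of the region $\{r>2,\ \frac{(k_1+k_2)^2}{r^2k_1k_2}>1\}$.
   Context: $c_{k_1,k_2}$ are the Fourier coefficients of the spectral density function $1/|p|^2$ of the stable polynomial $p$ on the torus $\mathbb{T}^2$. *)

theory Defs
  imports "HOL-Analysis.Analysis"
begin

definition pol :: "real \<Rightarrow> complex \<Rightarrow> complex \<Rightarrow> complex" where
  "pol r z1 z2 = 1 - (z1 + z2) / complex_of_real r"

definition coef :: "real \<Rightarrow> int \<Rightarrow> int \<Rightarrow> complex" where
  "coef r k1 k2 =
     integral (cbox (0, 0) (2 * pi, 2 * pi))
       (\<lambda>(\<theta>1::real, \<theta>2::real).
          exp (- \<i> * complex_of_real (of_int k1 * \<theta>1 + of_int k2 * \<theta>2))
          / complex_of_real ((cmod (pol r (exp (\<i> * complex_of_real \<theta>1))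
                                       (exp (\<i> * complex_of_real \<theta>2)))) ^ 2))
     / complex_of_real (4 * pi ^ 2)"

end

theory Submission
  imports Defs "HOL-Probability.Probability" "HOL-Real_Asymp.Real_Asymp"
begin

text \<open>Expanding \<open>1 / pol r\<close> and its conjugate into geometric series, Vandermonde's identity gives
  \<open>c\<^bsub>k1,k2\<^esub> = (\<Sum>n. C(2 n + k1 + k2, n + k1) / r ^ (2 n + k1 + k2))\<close>.

  Let \<open>1/2 < p < 1\<close> be the probability with \<open>p * (1 - p) = 1 / r\<^sup>2\<close>. Dividing by the
  \<open>(k1 - k2)\<close>-th power of \<open>r/2 - sqrt (r\<^sup>2/4 - 1) = r * (1 - p)\<close> turns the summands into binomial
  probabilities, so the normalised coefficient is the expected number of visits of a random walk with
  up-probability \<open>p\<close> to level \<open>k1 - k2\<close> from time \<open>k1 + k2\<close> on. The three cases say that this time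
  lies after, at, or before the typical hitting time, i.e. that \<open>p\<close> is larger than, equal to or
  smaller than \<open>P = k1 / (k1 + k2)\<close>.

  In case (i) the successive ratios of the series are bounded by, and converge to, the given quotient,
  and Tannery's theorem applies. In case (ii) the visits are expressed through the distribution
  function of a binomial law at its mean, which tends to one half. In case (iii) the visits before
  time \<open>t * (k1 + k2)\<close> are exponentially rare. The asymptotics of the central binomial probability
  and of the distribution function both come from Laplace's method for the Beta integral.
  The errors in (i) and (iii) have bounds monotone in \<open>r\<close>, so that on a compact set (which involves
  only finitely many pairs \<open>(k1, k2)\<close>) an extremal \<open>r\<close> controls them.\<close>

section \<open>Binomial distribution functions and random walks\<close>

definition bin_cdf :: "nat \<Rightarrow> nat \<Rightarrow> real \<Rightarrow> real" where
  "bin_cdf N k p = (\<Sum>i\<le>k. Bernstein N i p)"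

text \<open>Condition on the last trial; the case split only treats the boundary values of the
  binomial coefficients.\<close>

lemma Bernstein_Suc_Suc:
  "Bernstein (Suc N) (Suc k) p = p * Bernstein N k p + (1 - p) * Bernstein N (Suc k) p"
proof (cases "k < N")
  case True
  then have "N - k = Suc (N - Suc k)" by simp
  then show ?thesis by (simp add: Bernstein_def algebra_simps)
qed (cases "k = N"; simp add: Bernstein_def binomial_eq_0)

lemma bin_cdf_Suc: "bin_cdf N (Suc k) p = bin_cdf N k p + Bernstein N (Suc k) p"
  by (simp add: bin_cdf_def)

text \<open>One more trial pushes the success count above \<open>k\<close> only from exactly
  \<open>k\<close>, and then only by a success.\<close>

lemma bin_cdf_Suc_trials: "bin_cdf (Suc N) k p = bin_cdf N k p - p * Bernstein N k p"
proof (induction k)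
  case 0
  then show ?case by (simp add: bin_cdf_def Bernstein_def algebra_simps)
next
  case (Suc k)
  then show ?case by (simp add: bin_cdf_Suc Bernstein_Suc_Suc algebra_simps)
qed

lemma one_minus_bin_cdf:
  assumes "k \<le> N"
  shows "1 - bin_cdf N k p = (\<Sum>i\<in>{k<..N}. Bernstein N i p)"
proof -
  have "{..N} = {..k} \<union> {k<..N}" using assms by auto
  then have "(\<Sum>i\<le>N. Bernstein N i p) = bin_cdf N k p + (\<Sum>i\<in>{k<..N}. Bernstein N i p)"
    by (simp only: bin_cdf_def) (subst sum.union_disjoint, auto)
  then show ?thesis by (simp add: sum_Bernstein)
qed

text \<open>With two more trials and the threshold raised by one, only two kinds of paths change
  sides: \<open>Suc k\<close> successes followed by two failures enter the event, \<open>k\<close>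
  successes followed by two successes leave it.\<close>

lemma bin_cdf_two_steps:
  "bin_cdf (Suc (Suc N)) (Suc k) p
     = bin_cdf N k p + (1 - p)^2 * Bernstein N (Suc k) p - p^2 * Bernstein N k p"
  by (simp add: bin_cdf_Suc bin_cdf_Suc_trials Bernstein_Suc_Suc algebra_simps power2_eq_square)

text \<open>Exchanging up- and down-probability multiplies the weight of a path ending at level
  \<open>d\<close> by \<open>((1 - p) / p)^d\<close>. The second equation concerns level
  \<open>d + 2\<close>, whose two extra powers appear as \<open>p^2\<close> and
  \<open>(1 - p)^2\<close>.\<close>

lemma Bernstein_reflect:
  assumes "0 < p" "p < 1"
  shows "(p / (1 - p))^d * Bernstein (2 * J + d) (J + d) (1 - p) = Bernstein (2 * J + d) (J + d) p"
    and "(p / (1 - p))^d * (p^2 * Bernstein (2 * J + d) (Suc (J + d)) (1 - p))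
           = (1 - p)^2 * Bernstein (2 * J + d) (Suc (J + d)) p"
proof -
  have e: "2 * J + d - (J + d) = J" by simp
  show "(p / (1 - p))^d * Bernstein (2 * J + d) (J + d) (1 - p) = Bernstein (2 * J + d) (J + d) p"
    using assms by (simp add: Bernstein_def e power_divide power_add field_simps)
  show "(p / (1 - p))^d * (p^2 * Bernstein (2 * J + d) (Suc (J + d)) (1 - p))
           = (1 - p)^2 * Bernstein (2 * J + d) (Suc (J + d)) p"
  proof (cases J)
    case 0
    then show ?thesis by (simp add: Bernstein_def)
  next
    case (Suc j)
    then have e: "2 * J + d - Suc (J + d) = j" by simp
    show ?thesis using assms unfolding Bernstein_def e Suc
      by (simp add: power_divide power_add field_simps power2_eq_square)
  qed
qed

text \<open>The sum on the left is the expected number of visits to level \<open>d\<close>, before time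
  \<open>2 * J + d\<close>, of the random walk with up-probability \<open>p\<close>; the reflection principle accounts for
  the last term on the right.\<close>

lemma sum_Bernstein_diagonal:
  assumes "0 < p" "p < 1"
  shows "(2 * p - 1) * (\<Sum>j<J. Bernstein (2 * j + d) (j + d) p)
    = 1 - bin_cdf (2 * J + d) (J + d) p
        - (p / (1 - p))^d * (1 - bin_cdf (2 * J + d) (J + d) (1 - p))"
proof (induction J)
  case 0
  have "bin_cdf d d x = 1" for x by (simp add: bin_cdf_def sum_Bernstein)
  then show ?case by simp
next
  case (Suc J)
  let ?N = "2 * J + d" and ?k = "J + d"
  let ?a = "(p / (1 - p))^d"
  have s: "2 * Suc J + d = Suc (Suc ?N)" "Suc J + d = Suc ?k" by simp_all
  note r1 = Bernstein_reflect(1)[OF assms, of d J] and r2 = Bernstein_reflect(2)[OF assms, of d J]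
  have "?a * (1 - bin_cdf (Suc (Suc ?N)) (Suc ?k) (1 - p))
      = ?a * (1 - bin_cdf ?N ?k (1 - p)) - ?a * (p^2 * Bernstein ?N (Suc ?k) (1 - p))
        + (1 - p)^2 * (?a * Bernstein ?N ?k (1 - p))"
    by (simp add: bin_cdf_two_steps algebra_simps del: power_divide)
  also have "\<dots> = ?a * (1 - bin_cdf ?N ?k (1 - p)) - (1 - p)^2 * Bernstein ?N (Suc ?k) p
        + (1 - p)^2 * Bernstein ?N ?k p"
    unfolding r1 r2 by simp
  \<comment> \<open>Both sides gain the same amount: the contributions at \<open>Suc ?k\<close>
    cancel, and those at \<open>?k\<close> leave the factor
    \<open>p^2 - (1 - p)^2 = 2 * p - 1\<close>.\<close>
  finally show ?case
    unfolding s using Suc by (simp add: bin_cdf_two_steps algebra_simps power2_eq_square)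
qed

text \<open>Crude union bound: the binomial coefficients of a row sum to \<open>2^N\<close>, so a
  uniform bound on the path weights suffices.\<close>

lemma sum_Bernstein_le:
  assumes "A \<subseteq> {..N}" "\<And>i. i \<in> A \<Longrightarrow> p^i * (1 - p)^(N - i) \<le> C" "0 \<le> C"
  shows "(\<Sum>i\<in>A. Bernstein N i p) \<le> 2^N * C"
proof -
  have "(\<Sum>i\<in>A. Bernstein N i p) \<le> (\<Sum>i\<in>A. real (N choose i) * C)"
    unfolding Bernstein_def mult.assoc
    by (intro sum_mono mult_left_mono assms(2)) simp_all
  also have "\<dots> \<le> (\<Sum>i\<le>N. real (N choose i) * C)"
    using assms by (intro sum_mono2) auto
  also have "\<dots> = 2^N * C"
    by (simp add: choose_row_sum flip: sum_distrib_right of_nat_sum)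
  finally show ?thesis .
qed

text \<open>With the total exponent fixed, moving \<open>k - i\<close> factors from the smaller base
  \<open>b\<close> to the larger base \<open>a\<close> can only increase the product.\<close>

lemma power_shift_le:
  fixes a b :: real
  assumes "0 \<le> b" "b \<le> a" "i \<le> k" "k \<le> N"
  shows "a^i * b^(N - i) \<le> a^k * b^(N - k)"
proof -
  have e: "N - i = (N - k) + (k - i)" "k = i + (k - i)" using assms by auto
  have "a^i * b^(N - i) = a^i * b^(N - k) * b^(k - i)" by (subst e(1)) (simp add: power_add)
  also have "\<dots> \<le> a^i * b^(N - k) * a^(k - i)" using assms by (intro mult_left_mono power_mono) auto
  also have "\<dots> = a^k * b^(N - k)" by (subst (3) e(2)) (simp add: power_add)
  finally show ?thesis .
qed

text \<open>Let the time horizon in \<open>sum_Bernstein_diagonal\<close> tend to infinity: both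
  correction terms vanish, and the expected total number of visits to a level is the reciprocal of
  the drift \<open>2 * p - 1\<close>.\<close>

lemma Bernstein_diagonal_sums:
  assumes "1/2 < p" "p < 1"
  shows "(\<lambda>j. Bernstein (2 * j + d) (j + d) p) sums (1 / (2 * p - 1))"
proof -
  define q where "q = 1 - p"
  have pq: "0 < q" "q < p" "1 - p = q" "1 - q = p" "0 < p" using assms by (auto simp: q_def)
  \<comment> \<open>One bound serves both correction terms. It is a multiple of
    \<open>(4 * p * q)^J\<close>, and \<open>4 * p * q < 1\<close> because \<open>p\<close> differs
    from 1/2.\<close>
  define C where "C J = 2^(2 * J + d) * (p^(J + d) * q^J)" for J
  have C: "C \<longlonglongrightarrow> 0"
  proof -
    have "4 * p * q < 1"
    proof -
      have "0 < (2 * p - 1)^2" using assms by simp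
      then show ?thesis by (simp add: q_def power2_eq_square algebra_simps)
    qed
    then have "(\<lambda>J. (4 * p * q)^J * (2 * p)^d) \<longlonglongrightarrow> 0 * (2 * p)^d"
      using pq by (intro tendsto_intros LIMSEQ_realpow_zero) auto
    moreover have "C = (\<lambda>J. (4 * p * q)^J * (2 * p)^d)"
      by (simp add: C_def fun_eq_iff power_add power_mult power_mult_distrib)
    ultimately show ?thesis by simp
  qed
  have le1: "bin_cdf (2 * J + d) (J + d) p \<le> C J" for J
    unfolding bin_cdf_def C_def
  proof (rule sum_Bernstein_le)
    show "p^i * (1 - p)^(2 * J + d - i) \<le> p^(J + d) * q^J" if "i \<in> {..J + d}" for i
      using power_shift_le[of q p i "J + d" "2 * J + d"] that pq unfolding pq(3) by simp
  qed (use pq in auto)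
  have le2: "(p / (1 - p))^d * (1 - bin_cdf (2 * J + d) (J + d) (1 - p)) \<le> C J" for J
  proof -
    have "1 - bin_cdf (2 * J + d) (J + d) q \<le> 2^(2 * J + d) * (q^(J + d) * p^J)"
    proof (subst one_minus_bin_cdf, simp, rule sum_Bernstein_le)
      show "q^i * (1 - q)^(2 * J + d - i) \<le> q^(J + d) * p^J" if "i \<in> {J + d<..2 * J + d}" for i
      proof -
        have "2 * J + d - i \<le> J" "2 * J + d - (2 * J + d - i) = i" using that by auto
        then show ?thesis
          using power_shift_le[of q p "2 * J + d - i" J "2 * J + d"] pq unfolding pq(4)
          by (simp add: mult.commute)
      qed
    qed (use pq in auto)
    then have "(p / q)^d * (1 - bin_cdf (2 * J + d) (J + d) q)
        \<le> (p / q)^d * (2^(2 * J + d) * (q^(J + d) * p^J))"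
      using pq by (intro mult_left_mono) auto
    also have "\<dots> = C J" using pq by (simp add: C_def power_divide power_add field_simps)
    finally show ?thesis unfolding pq(3) .
  qed
  have nn: "0 \<le> bin_cdf (2 * J + d) (J + d) p"
      "0 \<le> (p / (1 - p))^d * (1 - bin_cdf (2 * J + d) (J + d) (1 - p))" for J
  proof -
    show "0 \<le> bin_cdf (2 * J + d) (J + d) p"
      unfolding bin_cdf_def using assms by (intro sum_nonneg Bernstein_nonneg) auto
    show "0 \<le> (p / (1 - p))^d * (1 - bin_cdf (2 * J + d) (J + d) (1 - p))"
      using assms by (subst one_minus_bin_cdf) (auto intro!: mult_nonneg_nonneg sum_nonneg Bernstein_nonneg)
  qed
  have l1: "(\<lambda>J. bin_cdf (2 * J + d) (J + d) p) \<longlonglongrightarrow> 0"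
    by (rule tendsto_sandwich[OF _ _ tendsto_const C]) (use le1 nn in auto)
  have l2: "(\<lambda>J. (p / (1 - p))^d * (1 - bin_cdf (2 * J + d) (J + d) (1 - p))) \<longlonglongrightarrow> 0"
    by (rule tendsto_sandwich[OF _ _ tendsto_const C]) (use le2 nn in auto)
  have "(\<lambda>J. (1 - bin_cdf (2 * J + d) (J + d) p
        - (p / (1 - p))^d * (1 - bin_cdf (2 * J + d) (J + d) (1 - p))) / (2 * p - 1))
      \<longlonglongrightarrow> (1 - 0 - 0) / (2 * p - 1)"
    using assms by (intro tendsto_intros l1 l2) auto
  moreover have "(1 - bin_cdf (2 * J + d) (J + d) p
        - (p / (1 - p))^d * (1 - bin_cdf (2 * J + d) (J + d) (1 - p))) / (2 * p - 1)
        = (\<Sum>j<J. Bernstein (2 * j + d) (j + d) p)" for J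
    using sum_Bernstein_diagonal[of p d J] assms by (simp add: field_simps)
  ultimately show ?thesis by (simp add: sums_def)
qed

text \<open>After reflection, the terms beyond \<open>J + d\<close> are dominated by a geometric
  series of ratio \<open>q / p\<close> starting from the single probability on the right; the factor
  \<open>p / (2 * p - 1)\<close> is the sum of that series. This makes the reflected term of
  \<open>sum_Bernstein_diagonal\<close> negligible in the critical case.\<close>

lemma bin_cdf_tail_le:
  assumes "1/2 < p" "p < 1"
  shows "(p / (1 - p))^d * (1 - bin_cdf (2 * J + d) (J + d) (1 - p))
           \<le> Bernstein (2 * J + d) (J + d) p * (p / (2 * p - 1))"
proof -
  define q where "q = 1 - p"
  have pq: "0 < q" "q < p" "1 - p = q" "1 - q = p" "0 < p" using assms by (auto simp: q_def)
  let ?N = "2 * J + d" and ?k = "J + d"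
  have term_le: "(p / q)^d * Bernstein ?N (?k + l) q \<le> Bernstein ?N ?k p * (q / p)^l" if "l \<le> J" for l
  proof -
    have e: "?N - (?k + l) = J - l" "?N - ?k = J" using that by auto
    have pj: "p^J = p^(J - l) * p^l" using that by (simp flip: power_add)
    \<comment> \<open>The index \<open>?k\<close> is at or past the middle of the row, so binomial
      coefficients decrease from there on; passing to complementary indices allows
      \<open>binomial_mono\<close> to be used.\<close>
    have "?N choose (?k + l) \<le> ?N choose ?k"
    proof -
      have "?N choose (?k + l) = ?N choose (J - l)"
        using that by (subst binomial_symmetric) (auto simp: e)
      also have "\<dots> \<le> ?N choose J" by (rule binomial_mono) auto
      also have "\<dots> = ?N choose ?k" by (subst binomial_symmetric) (auto simp: e)
      finally show ?thesis .
    qed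
    then have h1: "real (?N choose (?k + l)) * (p^?k * q^J * (q / p)^l)
        \<le> real (?N choose ?k) * (p^?k * q^J * (q / p)^l)"
      using pq by (intro mult_right_mono) auto
    have h2: "(p / q)^d * Bernstein ?N (?k + l) q
        = real (?N choose (?k + l)) * (p^?k * q^J * (q / p)^l)"
      unfolding Bernstein_def e pq(4) using pq(1,5)
      by (simp add: power_divide power_add pj field_simps)
    have h3: "Bernstein ?N ?k p * (q / p)^l
        = real (?N choose ?k) * (p^?k * q^J * (q / p)^l)"
      by (simp add: Bernstein_def e pq(3))
    show ?thesis unfolding h2 h3 by (rule h1)
  qed
  have "(p / q)^d * (1 - bin_cdf ?N ?k q) = (\<Sum>i\<in>{?k<..?N}. (p / q)^d * Bernstein ?N i q)"
    by (subst one_minus_bin_cdf) (auto simp: sum_distrib_left)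
  also have "\<dots> = (\<Sum>l\<in>{0<..J}. (p / q)^d * Bernstein ?N (?k + l) q)"
    by (rule sum.reindex_bij_witness[of _ "\<lambda>l. ?k + l" "\<lambda>i. i - ?k"]) auto
  also have "\<dots> \<le> (\<Sum>l\<in>{0<..J}. Bernstein ?N ?k p * (q / p)^l)"
    by (intro sum_mono term_le) auto
  also have "\<dots> = Bernstein ?N ?k p * (\<Sum>l\<in>{0<..J}. (q / p)^l)" by (simp add: sum_distrib_left)
  also have "\<dots> \<le> Bernstein ?N ?k p * (\<Sum>l. (q / p)^l)"
    using pq by (intro mult_left_mono sum_le_suminf summable_geometric Bernstein_nonneg) auto
  also have "(\<Sum>l. (q / p)^l) = p / (2 * p - 1)"
  proof -
    have "(\<Sum>l. (q / p)^l) = 1 / (1 - q / p)" using pq by (intro suminf_geometric) simp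
    then show ?thesis using assms by (simp add: q_def field_simps)
  qed
  finally show ?thesis unfolding pq(3) .
qed

text \<open>The derivative of each Bernstein polynomial is \<open>Suc N\<close> times a difference
  of two neighbours of degree \<open>N\<close>, so the derivative of the sum telescopes to its last
  term.\<close>

lemma has_real_derivative_bin_cdf:
  assumes "k \<le> N"
  shows "(bin_cdf (Suc N) k has_real_derivative - (real (Suc N) * Bernstein N k s)) (at s)"
  using assms
proof (induction k)
  case 0
  have "((\<lambda>s::real. (1 - s)^Suc N) has_real_derivative - (real (Suc N) * (1 - s)^N)) (at s)"
    by (rule DERIV_cong[OF DERIV_power[of _ "- 1"]]) (auto intro!: derivative_eq_intros)
  then show ?case by (simp add: bin_cdf_def[abs_def] Bernstein_def)
next
  case (Suc k)
  \<comment> \<open>Two absorption identities lower the degree, on the success side and on the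
    failure side respectively.\<close>
  have *: "real (Suc N choose Suc k) * real (Suc k) = real (Suc N) * real (N choose k)"
    by (metis Suc_times_binomial_eq of_nat_mult)
  have **: "real (Suc N choose Suc k) * real (N - k) = real (Suc N) * real (N choose Suc k)"
  proof -
    have "(Suc N - Suc k) * (Suc N choose Suc k) = Suc N * (N choose Suc k)"
      by (metis binomial_absorb_comp diff_Suc_1)
    then show ?thesis by (metis diff_Suc_Suc mult.commute of_nat_mult)
  qed
  have "((\<lambda>s::real. s^Suc k) has_real_derivative real (Suc k) * s^k) (at s)"
    using DERIV_pow[of "Suc k" s] by simp
  moreover have "((\<lambda>s::real. (1 - s)^(N - k)) has_real_derivative
      - (real (N - k) * (1 - s)^(N - Suc k))) (at s)"
    by (rule DERIV_cong[OF DERIV_power[of _ "- 1"]]) (auto intro!: derivative_eq_intros)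
  ultimately have "((\<lambda>s. real (Suc N choose Suc k) * (s^Suc k * (1 - s)^(N - k))) has_real_derivative
      real (Suc N choose Suc k) * (s^Suc k * - (real (N - k) * (1 - s)^(N - Suc k))
         + real (Suc k) * s^k * (1 - s)^(N - k))) (at s)"
    by (intro DERIV_cmult DERIV_mult')
  then have "(Bernstein (Suc N) (Suc k) has_real_derivative
      real (Suc N choose Suc k) * (real (Suc k) * s^k * (1 - s)^(N - k)
         - s^Suc k * (real (N - k) * (1 - s)^(N - Suc k)))) (at s)"
    by (simp add: Bernstein_def[abs_def] mult.assoc)
  moreover have "real (Suc N choose Suc k) * (real (Suc k) * s^k * (1 - s)^(N - k)
         - s^Suc k * (real (N - k) * (1 - s)^(N - Suc k)))
       = real (Suc N) * Bernstein N k s - real (Suc N) * Bernstein N (Suc k) s" (is "?l = _")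
  proof -
    have "?l = (real (Suc N choose Suc k) * real (Suc k)) * (s^k * (1 - s)^(N - k))
         - (real (Suc N choose Suc k) * real (N - k)) * (s^Suc k * (1 - s)^(N - Suc k))"
      by (simp add: algebra_simps)
    then show ?thesis unfolding * ** by (simp add: Bernstein_def algebra_simps)
  qed
  ultimately have "((\<lambda>s. bin_cdf (Suc N) k s + Bernstein (Suc N) (Suc k) s) has_real_derivative
      - (real (Suc N) * Bernstein N k s)
      + (real (Suc N) * Bernstein N k s - real (Suc N) * Bernstein N (Suc k) s)) (at s)"
    using Suc by (intro DERIV_add) simp_all
  then show ?case unfolding bin_cdf_Suc[abs_def] by simp
qed

text \<open>The classical identity between a binomial distribution function and an incomplete Beta
  integral, to which Laplace's method is applied below.\<close>

lemma Bernstein_has_integral: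
  assumes "k \<le> N" "a \<le> b"
  shows "(Bernstein N k has_integral (bin_cdf (Suc N) k a - bin_cdf (Suc N) k b) / real (Suc N)) {a..b}"
proof -
  have "((\<lambda>s. - bin_cdf (Suc N) k s / real (Suc N)) has_real_derivative Bernstein N k s) (at s within {a..b})" for s
    by (rule derivative_eq_intros has_real_derivative_bin_cdf[THEN DERIV_subset] assms refl | simp)+
  then have "(Bernstein N k has_integral
      - bin_cdf (Suc N) k b / real (Suc N) - (- bin_cdf (Suc N) k a / real (Suc N))) {a..b}"
    by (intro fundamental_theorem_of_calculus assms)
       (auto simp: has_real_derivative_iff_has_vector_derivative)
  then show ?thesis by (simp add: diff_divide_distrib)
qed

lemma bin_cdf_at_1: "k < N \<Longrightarrow> bin_cdf N k 1 = 0"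
  by (auto simp: bin_cdf_def Bernstein_def intro!: sum.neutral)

section \<open>Laplace's method for the Beta integral\<close>

text \<open>The difference of the exponents, \<open>- x - x^2 / 2 - ln (1 - x)\<close>, vanishes at
  0 and has derivative \<open>x^2 / (1 - x)\<close>. The quadratic term provides the Gaussian
  majorant in \<open>g_le\<close>.\<close>

lemma one_minus_le_exp_quadratic:
  fixes b :: real
  assumes "0 \<le> b" "b \<le> 1"
  shows "1 - b \<le> exp (- b - b^2 / 2)"
proof (cases "b = 1")
  case False
  define h where "h x = - x - x^2 / 2 - ln (1 - x)" for x :: real
  have "h 0 \<le> h b"
  proof (rule DERIV_nonneg_imp_nondecreasing[OF assms(1)])
    fix x assume x: "0 \<le> x" "x \<le> b"
    then have "x < 1" using assms False by auto
    then have "(h has_real_derivative - 1 - x + 1 / (1 - x)) (at x)"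
      unfolding h_def by (auto intro!: derivative_eq_intros)
    moreover have "- 1 - x + 1 / (1 - x) = x^2 / (1 - x)"
      using \<open>x < 1\<close> by (simp add: field_simps power2_eq_square)
    ultimately show "\<exists>y. (h has_real_derivative y) (at x) \<and> 0 \<le> y"
      using \<open>x < 1\<close> by auto
  qed
  then have "ln (1 - b) \<le> - b - b^2 / 2" by (simp add: h_def)
  moreover have "1 - b > 0" using assms False by auto
  ultimately show ?thesis by (metis exp_le_cancel_iff exp_ln)
qed simp

lemma has_bochner_integral_half_gaussian:
  fixes c :: real
  assumes "c > 0"
  shows "has_bochner_integral lborel (\<lambda>x. indicator {0..} x * exp (- (c * x)\<^sup>2)) (sqrt pi / (2 * c))"
proof -
  have "has_bochner_integral lborel
      (\<lambda>x. indicator {0..} (0 + c * x) *\<^sub>R exp (- (0 + c * x)\<^sup>2)) ((sqrt pi / 2) /\<^sub>R \<bar>c\<bar>)"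
    using gaussian_moment_0 assms by (subst (asm) lborel_has_bochner_integral_real_affine_iff[of c _ _ 0]) auto
  moreover have "indicator {0..} (0 + c * x) = (indicator {0..} x :: real)" for x
    using assms by (auto simp: indicator_def zero_le_mult_iff)
  ultimately show ?thesis using assms by (simp add: field_simps)
qed

text \<open>Count failures instead of successes: among \<open>Suc N\<close> trials, more than
  \<open>k\<close> successes means at most \<open>N - k\<close> failures.\<close>

lemma bin_cdf_reflect:
  assumes "k \<le> N"
  shows "bin_cdf (Suc N) k p + bin_cdf (Suc N) (N - k) (1 - p) = 1"
proof -
  have "1 - bin_cdf (Suc N) k p = (\<Sum>i\<in>{k<..Suc N}. Bernstein (Suc N) i p)"
    using assms by (intro one_minus_bin_cdf) simp
  also have "\<dots> = (\<Sum>j\<le>N - k. Bernstein (Suc N) j (1 - p))"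
  proof (rule sum.reindex_bij_witness[of _ "\<lambda>j. Suc N - j" "\<lambda>i. Suc N - i"])
    fix i assume "i \<in> {k<..Suc N}"
    then have i: "i \<le> Suc N" by simp
    show "Bernstein (Suc N) (Suc N - i) (1 - p) = Bernstein (Suc N) i p"
      using i binomial_symmetric[OF i] by (simp add: Bernstein_def)
  qed (use assms in auto)
  finally show ?thesis by (simp add: bin_cdf_def)
qed

locale split_weights =
  fixes k1 k2 :: nat
  assumes k1_pos: "0 < k1" and k2_pos: "0 < k2"
begin

definition K :: real where "K = real (k1 + k2)"
text \<open>The critical success probability: \<open>t * k1\<close> is exactly the mean of the
  binomial law with \<open>t * (k1 + k2)\<close> trials and parameter \<open>P\<close>.\<close>

definition P :: real where "P = real k1 / K"
definition Q :: real where "Q = real k2 / K"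

lemma K_pos: "0 < K" and P_pos: "0 < P" and Q_pos: "0 < Q" and PQ: "1 - P = Q" "P + Q = 1"
  and k1_eq: "real k1 = K * P" and k2_eq: "real k2 = K * Q"
proof -
  show K: "0 < K" using k1_pos by (simp add: K_def)
  then show "0 < P" "0 < Q" "real k1 = K * P" "real k2 = K * Q"
    using k1_pos k2_pos by (simp_all add: P_def Q_def)
  have "P + Q = K / K" by (simp add: P_def Q_def K_def flip: add_divide_distrib)
  then show "P + Q = 1" "1 - P = Q" using K by simp_all
qed

text \<open>The Beta integrand divided by its value at \<open>s = P\<close>, where its maximum over
  the unit interval lies; equivalently a likelihood ratio between the parameters \<open>s\<close>
  and \<open>P\<close>.\<close>

definition g :: "nat \<Rightarrow> real \<Rightarrow> real" where
  "g t s = (s / P)^(t * k1) * ((1 - s) / Q)^(t * k2)"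

lemma g_nonneg: "P \<le> s \<Longrightarrow> s \<le> 1 \<Longrightarrow> 0 \<le> g t s"
  using P_pos Q_pos by (auto simp: g_def)

text \<open>The linear terms of the two exponents cancel because \<open>k1 / P = k2 / Q = K\<close>.
  Only the second factor contributes a quadratic term, so the Gaussian is wider than the limiting
  one but still integrable, as dominated convergence requires.\<close>

lemma g_le:
  assumes "P \<le> s" "s \<le> 1"
  shows "g t s \<le> exp (- (real t * K / (2 * Q)) * (s - P)^2)"
proof -
  define b where "b = (s - P) / Q"
  have b: "0 \<le> b" "b \<le> 1" "(1 - s) / Q = 1 - b"
    using assms P_pos Q_pos PQ by (auto simp: b_def field_simps)
  have "s / P = 1 + (s - P) / P" using P_pos by (simp add: field_simps)
  then have "s / P \<le> exp ((s - P) / P)" by (metis exp_ge_add_one_self)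
  then have "(s / P)^(t * k1) \<le> exp ((s - P) / P)^(t * k1)"
    using assms P_pos by (intro power_mono) auto
  moreover have "((1 - s) / Q)^(t * k2) \<le> exp (- b - b^2 / 2)^(t * k2)"
    unfolding b(3) using b one_minus_le_exp_quadratic by (intro power_mono) auto
  ultimately have "g t s \<le> exp ((s - P) / P)^(t * k1) * exp (- b - b^2 / 2)^(t * k2)"
    unfolding g_def using assms Q_pos by (intro mult_mono) auto
  also have "\<dots> = exp (real t * (real k1 * ((s - P) / P) + real k2 * (- b - b^2 / 2)))"
    by (simp add: exp_of_nat_mult[symmetric] exp_add[symmetric] algebra_simps)
  also have "real t * (real k1 * ((s - P) / P) + real k2 * (- b - b^2 / 2))
      = - (real t * K / (2 * Q)) * (s - P)^2"
    using P_pos Q_pos by (simp add: k1_eq k2_eq b_def field_simps power2_eq_square)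
  finally show ?thesis .
qed

text \<open>Second-order expansion of the logarithm at the peak, on the scale
  \<open>1 / sqrt t\<close>.\<close>

lemma g_tendsto:
  assumes "0 \<le> y"
  shows "(\<lambda>t. g t (P + y / sqrt (real t))) \<longlonglongrightarrow> exp (- (K / (2 * P * Q)) * y^2)"
proof -
  define a b where "a = y / P" and "b = y / Q"
  have "(\<lambda>t. real t * ln (1 + a / sqrt (real t)) - a * sqrt (real t)) \<longlonglongrightarrow> - (a * a / 2)"
    by real_asymp
  moreover have "(\<lambda>t. real t * ln (1 - b / sqrt (real t)) + b * sqrt (real t)) \<longlonglongrightarrow> - (b * b / 2)"
    by real_asymp
  ultimately have lim: "(\<lambda>t. exp (real k1 * (real t * ln (1 + a / sqrt (real t)) - a * sqrt (real t))
        + real k2 * (real t * ln (1 - b / sqrt (real t)) + b * sqrt (real t))))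
      \<longlonglongrightarrow> exp (real k1 * (- (a * a / 2)) + real k2 * (- (b * b / 2)))"
    by (intro tendsto_intros)
  have ev: "\<forall>\<^sub>F t in sequentially. exp (real k1 * (real t * ln (1 + a / sqrt (real t)) - a * sqrt (real t))
        + real k2 * (real t * ln (1 - b / sqrt (real t)) + b * sqrt (real t))) = g t (P + y / sqrt (real t))"
  proof -
    have "(\<lambda>t. 1 - b / sqrt (real t)) \<longlonglongrightarrow> 1" by real_asymp
    then have pos_ev: "\<forall>\<^sub>F t in sequentially. 0 < 1 - b / sqrt (real t)"
      by (rule order_tendstoD) simp
    show ?thesis
      using pos_ev
    proof eventually_elim
      case (elim t)
      \<comment> \<open>The linear terms, split off so that each logarithm has a finite limit,
        cancel each other: the first-order condition for the peak.\<close>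
      have ka: "real k1 * a = real k2 * b" using P_pos Q_pos by (simp add: k1_eq k2_eq a_def b_def)
      have pos: "0 < 1 + a / sqrt (real t)" using assms P_pos by (auto simp: a_def intro!: add_pos_nonneg)
      have 1: "(P + y / sqrt (real t)) / P = 1 + a / sqrt (real t)"
        using P_pos by (simp add: a_def field_simps)
      have 2: "(1 - (P + y / sqrt (real t))) / Q = 1 - b / sqrt (real t)"
        using Q_pos PQ by (simp add: b_def diff_divide_distrib[symmetric] field_simps)
      have "real k1 * (real t * ln (1 + a / sqrt (real t)) - a * sqrt (real t))
        + real k2 * (real t * ln (1 - b / sqrt (real t)) + b * sqrt (real t))
        = real (t * k1) * ln (1 + a / sqrt (real t)) + real (t * k2) * ln (1 - b / sqrt (real t))
          + (real k2 * b - real k1 * a) * sqrt (real t)"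
        by (simp add: algebra_simps)
      also have "exp \<dots> = g t (P + y / sqrt (real t))"
        unfolding g_def 1 2 ka using pos elim
        by (simp only: exp_add exp_of_nat_mult exp_ln) simp
      finally show ?case .
    qed
  qed
  have eq: "real k1 * (- (a * a / 2)) + real k2 * (- (b * b / 2)) = - (K / (2 * P * Q)) * y^2"
  proof -
    have "real k1 * (- (a * a / 2)) + real k2 * (- (b * b / 2)) = - (K * y^2 / (2 * P * Q)) * (P + Q)"
      using P_pos Q_pos by (simp add: k1_eq k2_eq a_def b_def field_simps power2_eq_square)
    then show ?thesis by (simp add: PQ)
  qed
  show ?thesis using Lim_transform_eventually[OF lim ev] unfolding eq .
qed

text \<open>Substitute \<open>s = P + y / sqrt t\<close> and apply dominated convergence; half a
  Gaussian integral remains.\<close>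

lemma half_integral_tendsto:
  "(\<lambda>t. sqrt (real t) * integral {P..1} (g t)) \<longlonglongrightarrow> sqrt (2 * pi * P * Q / K) / 2"
proof -
  define f where "f t y = indicator {P..1} (P + y / sqrt (real t)) * g t (P + y / sqrt (real t))" for t y
  define c where "c = sqrt (K / (2 * P * Q))"
  \<comment> \<open>\<open>c\<close> is the scale of the limiting Gaussian, \<open>c'\<close> the
    scale of the majorant supplied by \<open>g_le\<close>.\<close>
  define c' where "c' = sqrt (K / (2 * Q))"
  have c: "c > 0" "c^2 = K / (2 * P * Q)" "c' > 0" "c'^2 = K / (2 * Q)"
    using K_pos P_pos Q_pos by (auto simp: c_def c'_def)
  have integrable_g: "set_integrable lborel {P..1} (g t)" for t
    unfolding g_def using P_pos Q_pos by (intro borel_integrable_atLeastAtMost' continuous_intros) auto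
  have meas_g: "g t \<in> borel_measurable borel" for t
    unfolding g_def by measurable
  have f_int: "integral\<^sup>L lborel (f t) = sqrt (real t) * integral {P..1} (g t)" if "t > 0" for t
  proof -
    have "integral {P..1} (g t) = integral\<^sup>L lborel (\<lambda>s. indicator {P..1} s * g t s)"
      using set_borel_integral_eq_integral(2)[OF integrable_g[of t]] by (simp add: set_lebesgue_integral_def)
    also have "\<dots> = \<bar>1 / sqrt (real t)\<bar> *\<^sub>R integral\<^sup>L lborel (\<lambda>y. indicator {P..1} (P + 1 / sqrt (real t) * y) * g t (P + 1 / sqrt (real t) * y))"
      using that by (intro lborel_integral_real_affine) simp
    finally show ?thesis using that by (simp add: f_def[abs_def] field_simps)
  qed
  \<comment> \<open>The index is shifted because division by zero makes \<open>f 0\<close> the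
    constant 1, which no integrable function dominates.\<close>
  have "(\<lambda>t. integral\<^sup>L lborel (f (Suc t))) \<longlonglongrightarrow> integral\<^sup>L lborel (\<lambda>y. indicator {0..} y * exp (- (c * y)\<^sup>2))"
  proof (rule integral_dominated_convergence[where w = "\<lambda>y. indicator {0..} y * exp (- (c' * y)\<^sup>2)"])
    show "(\<lambda>y. indicator {0..} y * exp (- (c * y)\<^sup>2)) \<in> borel_measurable lborel" by measurable
    show "f (Suc t) \<in> borel_measurable lborel" for t
      unfolding f_def using meas_g by measurable
    show "integrable lborel (\<lambda>y. indicator {0..} y * exp (- (c' * y)\<^sup>2))"
      using has_bochner_integral_half_gaussian[OF c(3)] by (rule integrable.intros)
    show "AE y in lborel. (\<lambda>t. f (Suc t) y) \<longlonglongrightarrow> indicator {0..} y * exp (- (c * y)\<^sup>2)"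
    proof (rule AE_I2)
      fix y :: real
      show "(\<lambda>t. f (Suc t) y) \<longlonglongrightarrow> indicator {0..} y * exp (- (c * y)\<^sup>2)"
      proof (cases "0 \<le> y")
        case True
        have "(\<lambda>t. P + y / sqrt (real t)) \<longlonglongrightarrow> P" by real_asymp
        then have "\<forall>\<^sub>F t in sequentially. P + y / sqrt (real t) < 1"
          by (rule order_tendstoD) (use PQ Q_pos in simp)
        then have "\<forall>\<^sub>F t in sequentially. g t (P + y / sqrt (real t)) = f t y"
          by eventually_elim (use True in \<open>auto simp: f_def indicator_def\<close>)
        from Lim_transform_eventually[OF g_tendsto[OF True] this]
        have "(\<lambda>t. f t y) \<longlonglongrightarrow> exp (- (c * y)\<^sup>2)"
          by (simp add: power_mult_distrib c)
        then show ?thesis using True by (intro LIMSEQ_Suc) simp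
      next
        case False
        then have "f (Suc t) y = 0" for t
          by (auto simp: f_def indicator_def field_simps zero_le_divide_iff)
        then show ?thesis using False by simp
      qed
    qed
    show "AE y in lborel. norm (f (Suc t) y) \<le> indicator {0..} y * exp (- (c' * y)\<^sup>2)" for t
    proof (rule AE_I2)
      fix y :: real
      show "norm (f (Suc t) y) \<le> indicator {0..} y * exp (- (c' * y)\<^sup>2)"
      proof (cases "P + y / sqrt (real (Suc t)) \<in> {P..1}")
        case True
        then have y: "0 \<le> y" by (auto simp: zero_le_divide_iff)
        have "\<bar>g (Suc t) (P + y / sqrt (real (Suc t)))\<bar> = g (Suc t) (P + y / sqrt (real (Suc t)))"
          using True g_nonneg by auto
        also have "\<dots> \<le> exp (- (real (Suc t) * K / (2 * Q)) * (P + y / sqrt (real (Suc t)) - P)^2)"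
          using True by (intro g_le) auto
        also have "- (real (Suc t) * K / (2 * Q)) * (P + y / sqrt (real (Suc t)) - P)^2 = - (c' * y)\<^sup>2"
          using Q_pos by (simp add: power_mult_distrib c power_divide field_simps del: of_nat_Suc)
        finally show ?thesis using True y by (simp add: f_def)
      qed (auto simp: f_def)
    qed
  qed
  then have "(\<lambda>t. sqrt (real (Suc t)) * integral {P..1} (g (Suc t))) \<longlonglongrightarrow> sqrt pi / (2 * c)"
    using has_bochner_integral_integral_eq[OF has_bochner_integral_half_gaussian[OF c(1)]]
    by (simp add: f_int)
  moreover have "sqrt pi / (2 * c) = sqrt (2 * pi * P * Q / K) / 2"
    using K_pos P_pos Q_pos by (simp add: c_def real_sqrt_divide real_sqrt_mult field_simps)
  ultimately show ?thesis by (simp only: filterlim_sequentially_Suc[of "\<lambda>t. sqrt (real t) * integral {P..1} (g t)", symmetric])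
qed

text \<open>The Beta integral from the peak \<open>P\<close> to 1, where the distribution function
  vanishes, with the peak value of the integrand taken out.\<close>

lemma bin_cdf_eq_integral:
  "bin_cdf (Suc (t * (k1 + k2))) (t * k1) P
     = real (Suc (t * (k1 + k2))) * Bernstein (t * (k1 + k2)) (t * k1) P * integral {P..1} (g t)"
proof -
  let ?N = "t * (k1 + k2)" and ?k = "t * k1"
  have e: "?N - ?k = t * k2" by (simp add: algebra_simps)
  have k: "?k \<le> ?N" "?k < Suc ?N" by (simp_all add: algebra_simps)
  have "Bernstein ?N ?k s = Bernstein ?N ?k P * g t s" for s
    using P_pos Q_pos unfolding Bernstein_def e PQ(1) g_def by (simp add: power_divide)
  then have "integral {P..1} (Bernstein ?N ?k) = Bernstein ?N ?k P * integral {P..1} (g t)"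
    by (metis (no_types, lifting) ext integral_mult_right)
  moreover have "integral {P..1} (Bernstein ?N ?k) = bin_cdf (Suc ?N) ?k P / real (Suc ?N)"
    using Bernstein_has_integral[OF k(1), of P 1] PQ Q_pos bin_cdf_at_1[OF k(2)]
    by (intro integral_unique) simp
  ultimately show ?thesis by (simp add: nonzero_eq_divide_eq mult_ac del: of_nat_Suc)
qed

end

text \<open>Exchanging successes and failures exchanges \<open>P\<close> and \<open>Q\<close>, so
  results on the right half of the Beta integral also apply to its left half.\<close>

lemma split_weights_swap:
  assumes "split_weights k1 k2"
  shows "split_weights k2 k1" "split_weights.K k2 k1 = split_weights.K k1 k2"
    "split_weights.P k2 k1 = split_weights.Q k1 k2" "split_weights.Q k2 k1 = split_weights.P k1 k2"
proof -
  show s: "split_weights k2 k1" using assms by (simp add: split_weights_def)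
  note defs = split_weights.K_def[OF s] split_weights.P_def[OF s] split_weights.Q_def[OF s]
    split_weights.K_def[OF assms] split_weights.P_def[OF assms] split_weights.Q_def[OF assms]
  show "split_weights.K k2 k1 = split_weights.K k1 k2"
    "split_weights.P k2 k1 = split_weights.Q k1 k2" "split_weights.Q k2 k1 = split_weights.P k1 k2"
    by (simp_all add: defs add.commute)
qed

context split_weights begin

text \<open>The two halves of the Beta integral have the same leading asymptotics
  \<open>c / sqrt t\<close>. Their equality gives the limit 1/2; the fact that they account for
  total probability 1 determines the peak probability.\<close>

lemma cdf_and_peak_tendsto:
  shows bin_cdf_tendsto_half: "(\<lambda>t. bin_cdf (Suc (t * (k1 + k2))) (t * k1) P) \<longlonglongrightarrow> 1 / 2"
    and Bernstein_peak_tendsto: "(\<lambda>t. sqrt (real t) * Bernstein (t * (k1 + k2)) (t * k1) P)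
        \<longlonglongrightarrow> 1 / sqrt (2 * pi) * sqrt (real (k1 + k2) / (real k1 * real k2))"
proof -
  interpret swap: split_weights k2 k1 by (rule split_weights_swap(1)) unfold_locales
  note sw = split_weights_swap(2-)[OF split_weights_axioms]
  define c where "c = sqrt (2 * pi * P * Q / K) / 2"
  have c: "c > 0" using K_pos P_pos Q_pos by (simp add: c_def)
  define I where "I t = sqrt (real t) * integral {P..1} (g t)" for t
  define I' where "I' t = sqrt (real t) * integral {Q..1} (swap.g t)" for t
  define b where "b t = Bernstein (t * (k1 + k2)) (t * k1) P" for t
  define X where "X t = bin_cdf (Suc (t * (k1 + k2))) (t * k1) P" for t
  have I: "I \<longlonglongrightarrow> c" unfolding I_def c_def by (rule half_integral_tendsto)
  have I': "I' \<longlonglongrightarrow> c"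
    using swap.half_integral_tendsto unfolding I'_def c_def sw by (simp add: mult_ac)
  have X: "sqrt (real t) * X t = real (Suc (t * (k1 + k2))) * b t * I t" for t
    by (simp add: X_def b_def I_def bin_cdf_eq_integral)
  \<comment> \<open>The complementary probability is a distribution function of failures, hence the
    right half-integral for the exchanged weights.\<close>
  have X': "sqrt (real t) * (1 - X t) = real (Suc (t * (k1 + k2))) * b t * I' t" for t
  proof -
    let ?N = "t * (k1 + k2)"
    have e: "?N - t * k1 = t * k2" "?N - t * k2 = t * k1" by (simp_all add: algebra_simps)
    have k: "t * k1 \<le> ?N" "t * k2 \<le> ?N" by simp_all
    have "1 - X t = bin_cdf (Suc ?N) (t * k2) Q"
      using bin_cdf_reflect[OF k(1), of P] unfolding X_def e PQ by simp
    also have "\<dots> = real (Suc ?N) * Bernstein ?N (t * k2) Q * integral {Q..1} (swap.g t)"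
      using swap.bin_cdf_eq_integral[of t] unfolding sw by (simp add: add.commute)
    also have "Bernstein ?N (t * k2) Q = b t"
      unfolding b_def Bernstein_def e using binomial_symmetric[OF k(1)] PQ(2)
      by (simp add: e flip: PQ(1))
    finally show ?thesis by (simp add: I'_def)
  qed
  \<comment> \<open>Adding the two representations eliminates \<open>X t\<close>; this normalisation
    expresses \<open>b t\<close> through the integrals alone.\<close>
  have sum: "sqrt (real t) = real (Suc (t * (k1 + k2))) * b t * (I t + I' t)" for t
    using X[of t] X'[of t] by (simp add: algebra_simps)
  have ev: "\<forall>\<^sub>F t in sequentially. 0 < t \<and> 0 < I t + I' t"
  proof -
    have "\<forall>\<^sub>F t in sequentially. 0 < I t + I' t"
      using order_tendstoD(1)[OF tendsto_add[OF I I'], of 0] c by simp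
    with eventually_gt_at_top[of 0] show ?thesis by eventually_elim simp
  qed
  have "(\<lambda>t. I t / (I t + I' t)) \<longlonglongrightarrow> c / (c + c)"
    using c by (intro tendsto_intros I I') auto
  moreover have "\<forall>\<^sub>F t in sequentially. I t / (I t + I' t) = X t"
    using ev
  proof eventually_elim
    case (elim t)
    have "sqrt (real t) * (X t * (I t + I' t)) = (sqrt (real t) * X t) * (I t + I' t)" by simp
    also have "\<dots> = (real (Suc (t * (k1 + k2))) * b t * (I t + I' t)) * I t" unfolding X by simp
    also have "\<dots> = sqrt (real t) * I t" unfolding sum[symmetric] ..
    finally have "sqrt (real t) * (X t * (I t + I' t)) = sqrt (real t) * I t" .
    then have "X t * (I t + I' t) = I t" using elim by simp
    then show ?case using elim by (simp add: field_simps)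
  qed
  ultimately have "X \<longlonglongrightarrow> c / (c + c)" by (rule Lim_transform_eventually)
  then show "(\<lambda>t. bin_cdf (Suc (t * (k1 + k2))) (t * k1) P) \<longlonglongrightarrow> 1 / 2"
    using c by (simp add: X_def[abs_def] field_simps)
  have "(\<lambda>t. real t / real (Suc (t * (k1 + k2)))) \<longlonglongrightarrow> 1 / K"
    unfolding K_def of_nat_Suc of_nat_mult inverse_eq_divide[symmetric] of_nat_add
    using k1_pos by real_asymp
  then have "(\<lambda>t. real t / real (Suc (t * (k1 + k2))) / (I t + I' t)) \<longlonglongrightarrow> 1 / K / (c + c)"
    by (rule tendsto_divide[OF _ tendsto_add[OF I I']]) (use c in simp)
  moreover have "\<forall>\<^sub>F t in sequentially. real t / real (Suc (t * (k1 + k2))) / (I t + I' t) = sqrt (real t) * b t"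
    using ev
  proof eventually_elim
    case (elim t)
    have "real t = sqrt (real t) * (real (Suc (t * (k1 + k2))) * b t * (I t + I' t))"
      unfolding sum[symmetric] by simp
    also have "\<dots> = sqrt (real t) * b t * (real (Suc (t * (k1 + k2))) * (I t + I' t))"
      by (simp add: mult_ac del: of_nat_Suc)
    finally have "real t / (real (Suc (t * (k1 + k2))) * (I t + I' t)) = sqrt (real t) * b t"
      using elim by (subst nonzero_divide_eq_eq) auto
    then show ?case by (simp only: divide_divide_eq_left)
  qed
  ultimately have "(\<lambda>t. sqrt (real t) * b t) \<longlonglongrightarrow> 1 / K / (c + c)" by (rule Lim_transform_eventually)
  moreover have "1 / K / (c + c) = 1 / sqrt (2 * pi) * sqrt (real (k1 + k2) / (real k1 * real k2))"
  proof -
    have "sqrt K * sqrt K = K" using K_pos by simp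
    then have "1 / K / (c + c) = 1 / sqrt (2 * pi) * sqrt (K / (K * P * (K * Q)))"
      using K_pos P_pos Q_pos by (simp add: c_def real_sqrt_divide real_sqrt_mult field_simps)
    then show ?thesis by (simp only: k1_eq k2_eq K_def)
  qed
  ultimately show "(\<lambda>t. sqrt (real t) * Bernstein (t * (k1 + k2)) (t * k1) P)
        \<longlonglongrightarrow> 1 / sqrt (2 * pi) * sqrt (real (k1 + k2) / (real k1 * real k2))"
    by (simp add: b_def)
qed

end

section \<open>The Fourier coefficients as a series\<close>

lemma integral_cis_multiple:
  "integral {0..2 * pi} (\<lambda>x. cis (of_int n * x)) = (if n = 0 then complex_of_real (2 * pi) else 0)"
proof (cases "n = 0")
  case True
  then show ?thesis by (simp add: scaleR_conv_of_real)
next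
  case False
  have "((\<lambda>x. cis (of_int n * x) / (\<i> * of_int n)) has_vector_derivative cis (of_int n * x))
      (at x within {0..2 * pi})" for x
  proof -
    have "((\<lambda>z. exp (\<i> * of_int n * z) / (\<i> * of_int n)) has_field_derivative
        exp (\<i> * of_int n * of_real x)) (at (of_real x))"
      using False by (auto intro!: derivative_eq_intros)
    then have "((\<lambda>x. exp (\<i> * of_int n * of_real x) / (\<i> * of_int n)) has_vector_derivative
        exp (\<i> * of_int n * of_real x)) (at x within {0..2 * pi})"
      by (rule has_vector_derivative_real_field)
    then show ?thesis by (simp add: cis_conv_exp mult.assoc)
  qed
  then have "((\<lambda>x. cis (of_int n * x)) has_integral
      cis (of_int n * (2 * pi)) / (\<i> * of_int n) - cis (of_int n * 0) / (\<i> * of_int n)) {0..2 * pi}"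
    by (intro fundamental_theorem_of_calculus) auto
  moreover have "cis (of_int n * (2 * pi)) = 1"
    using cis_multiple_2pi[of "of_int n"] by (simp add: mult_ac)
  ultimately show ?thesis using False by (simp add: integral_unique)
qed

lemma integral_torus_character:
  "integral (cbox (0, 0) (2 * pi, 2 * pi)) (\<lambda>(x, y). cis (of_int m * x) * cis (of_int n * y))
     = (if m = 0 \<and> n = 0 then complex_of_real (4 * pi^2) else 0)"
proof -
  have "integral (cbox (0, 0) (2 * pi, 2 * pi)) (\<lambda>(x, y). cis (of_int m * x) * cis (of_int n * y))
      = integral (cbox 0 (2 * pi)) (\<lambda>x. integral (cbox 0 (2 * pi)) (\<lambda>y. cis (of_int m * x) * cis (of_int n * y)))"
    by (subst integral_prod_continuous) (auto intro!: continuous_intros simp: case_prod_beta)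
  also have "\<dots> = integral {0..2 * pi} (\<lambda>x. cis (of_int m * x)) * integral {0..2 * pi} (\<lambda>y. cis (of_int n * y))"
    by simp
  also have "\<dots> = (if m = 0 \<and> n = 0 then complex_of_real (4 * pi^2) else 0)"
    unfolding integral_cis_multiple by (simp add: power2_eq_square)
  finally show ?thesis .
qed

text \<open>Vandermonde's identity after symmetry of the second coefficient; the terms with
  \<open>k < k1\<close> vanish since there \<open>n + k1 - k\<close> exceeds
  \<open>n\<close>.\<close>

lemma vandermonde_shift:
  "(\<Sum>b\<le>n. ((n + k1 + k2) choose (b + k1)) * (n choose b)) = (2 * n + k1 + k2) choose (n + k1)"
proof -
  let ?f = "\<lambda>k. ((n + k1 + k2) choose k) * (n choose (n + k1 - k))"
  have "(2 * n + k1 + k2) choose (n + k1) = (\<Sum>k\<le>n + k1. ?f k)"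
    using vandermonde[of "n + k1 + k2" n "n + k1"] by (simp add: mult_2 add_ac)
  also have "\<dots> = (\<Sum>k\<in>{k1..n + k1}. ?f k)"
    by (rule sum.mono_neutral_right) (auto simp: binomial_eq_0)
  also have "\<dots> = (\<Sum>b\<le>n. ?f (b + k1))"
    by (rule sum.reindex_bij_witness[of _ "\<lambda>b. b + k1" "\<lambda>k. k - k1"]) auto
  also have "\<dots> = (\<Sum>b\<le>n. ((n + k1 + k2) choose (b + k1)) * (n choose b))"
    by (intro sum.cong refl) (simp add: binomial_symmetric[symmetric])
  finally show ?thesis by simp
qed

lemma integral_double_sum:
  fixes f :: "'i \<Rightarrow> 'j \<Rightarrow> 'a::euclidean_space \<Rightarrow> complex"
  assumes "finite A" "finite B" "\<And>a b. f a b integrable_on S"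
  shows "integral S (\<lambda>z. \<Sum>a\<in>A. \<Sum>b\<in>B. c a b * f a b z) = (\<Sum>a\<in>A. \<Sum>b\<in>B. c a b * integral S (f a b))"
  using assms by (intro integral_unique has_integral_sum has_integral_mult_right integrable_integral)

text \<open>Expand both powers binomially; orthogonality of characters retains one diagonal of the
  double sum, which \<open>vandermonde_shift\<close> evaluates.\<close>

lemma integral_torus_monomial:
  "integral (cbox (0, 0) (2 * pi, 2 * pi))
     (\<lambda>(x, y). cis (- (real k1 * x + real k2 * y)) * (cis x + cis y)^m * cnj (cis x + cis y)^n)
   = (if m = n + k1 + k2 then complex_of_real (4 * pi^2 * real ((m + n) choose (n + k1))) else 0)"
  (is "integral ?B ?f = _")
proof -
  let ?t = "\<lambda>a b. of_nat (m choose a) * of_nat (n choose b) :: complex"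
  let ?i = "\<lambda>a b. int a - int b - int k1" and ?j = "\<lambda>a b. int m - int a - int n + int b - int k2"
  have expand: "?f (x, y) = (\<Sum>a\<le>m. \<Sum>b\<le>n. ?t a b * (cis (of_int (?i a b) * x) * cis (of_int (?j a b) * y)))"
    for x y
  proof -
    have "(cis x + cis y)^m = (\<Sum>a\<le>m. of_nat (m choose a) * cis x^a * cis y^(m - a))"
      by (rule binomial_ring)
    moreover have "cnj (cis x + cis y)^n = (\<Sum>b\<le>n. of_nat (n choose b) * cis (- x)^b * cis (- y)^(n - b))"
      by (simp add: cis_cnj binomial_ring)
    ultimately have "?f (x, y) = (\<Sum>a\<le>m. \<Sum>b\<le>n. cis (- (real k1 * x + real k2 * y))
        * ((of_nat (m choose a) * cis x^a * cis y^(m - a)) * (of_nat (n choose b) * cis (- x)^b * cis (- y)^(n - b))))"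
      by (simp only: case_prod_conv mult.assoc sum_product) (simp add: sum_distrib_left)
    also have "\<dots> = (\<Sum>a\<le>m. \<Sum>b\<le>n. ?t a b * (cis (of_int (?i a b) * x) * cis (of_int (?j a b) * y)))"
    proof (intro sum.cong refl)
      fix a b assume ab: "a \<in> {..m}" "b \<in> {..n}"
      have "cis (- (real k1 * x + real k2 * y)) * (cis x^a * cis y^(m - a) * (cis (- x)^b * cis (- y)^(n - b)))
          = cis (of_int (?i a b) * x) * cis (of_int (?j a b) * y)"
        using ab by (simp add: Complex.DeMoivre cis_mult of_nat_diff algebra_simps)
      then show "cis (- (real k1 * x + real k2 * y))
        * ((of_nat (m choose a) * cis x^a * cis y^(m - a)) * (of_nat (n choose b) * cis (- x)^b * cis (- y)^(n - b)))
        = ?t a b * (cis (of_int (?i a b) * x) * cis (of_int (?j a b) * y))"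
        by (simp add: mult_ac)
    qed
    finally show ?thesis .
  qed
  have cont: "(\<lambda>(x, y). cis (of_int i * x) * cis (of_int j * y)) integrable_on ?B" for i j
    unfolding case_prod_beta by (intro integrable_continuous continuous_intros)
  have "integral ?B ?f = integral ?B (\<lambda>z. \<Sum>a\<le>m. \<Sum>b\<le>n. ?t a b *
      (case z of (x, y) \<Rightarrow> cis (of_int (?i a b) * x) * cis (of_int (?j a b) * y)))"
    using expand by (intro arg_cong2[of _ _ _ _ integral] refl ext) (auto split: prod.splits)
  also have "\<dots> = (\<Sum>a\<le>m. \<Sum>b\<le>n. ?t a b * integral ?B (\<lambda>(x, y). cis (of_int (?i a b) * x) * cis (of_int (?j a b) * y)))"
    by (rule integral_double_sum) (simp_all only: finite_atMost cont)
  \<comment> \<open>Both frequencies vanish exactly when \<open>a = b + k1\<close> and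
    \<open>m - a = n - b + k2\<close>, which together force \<open>m = n + k1 + k2\<close>.\<close>
  also have "\<dots> = (\<Sum>a\<le>m. \<Sum>b\<le>n. if m = n + k1 + k2 \<and> a = b + k1 then ?t a b * complex_of_real (4 * pi^2) else 0)"
    unfolding integral_torus_character by (intro sum.cong refl) auto
  also have "\<dots> = (\<Sum>b\<le>n. \<Sum>a\<le>m. if m = n + k1 + k2 \<and> a = b + k1 then ?t a b * complex_of_real (4 * pi^2) else 0)"
    by (rule sum.swap)
  also have "\<dots> = (if m = n + k1 + k2 then complex_of_real (4 * pi^2 * real ((m + n) choose (n + k1))) else 0)"
  proof (cases "m = n + k1 + k2")
    case True
    then have "(\<Sum>b\<le>n. \<Sum>a\<le>m. if m = n + k1 + k2 \<and> a = b + k1 then ?t a b * complex_of_real (4 * pi^2) else 0)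
        = (\<Sum>b\<le>n. ?t (b + k1) b * complex_of_real (4 * pi^2))"
      by (intro sum.cong refl) simp
    also have "\<dots> = of_nat (\<Sum>b\<le>n. (m choose (b + k1)) * (n choose b)) * complex_of_real (4 * pi^2)"
      by (simp add: sum_distrib_right)
    also have "(\<Sum>b\<le>n. (m choose (b + k1)) * (n choose b)) = (m + n) choose (n + k1)"
      using vandermonde_shift[of n k1 k2] True by (simp add: mult_2 add_ac)
    finally show ?thesis using True by simp
  qed simp
  finally show ?thesis .
qed

lemma norm_cis_add_le: "norm (cis x + cis y) \<le> 2"
  using norm_triangle_ineq[of "cis x" "cis y"] by simp

text \<open>The density is \<open>L z * cnj (L z)\<close> with \<open>L\<close> a geometric series
  in \<open>w\<close>. Since \<open>norm (w z)\<close> is at most \<open>2 / r < 1\<close>, the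
  partial sums converge uniformly on the torus and the integral may be taken term by term.\<close>

lemma coef_sums:
  assumes "r > 2"
  shows "(\<lambda>n. complex_of_real (real ((2 * n + k1 + k2) choose (n + k1)) / r^(2 * n + k1 + k2)))
           sums coef r (int k1) (int k2)"
proof -
  let ?B = "cbox (0, 0) (2 * pi, 2 * pi) :: (real \<times> real) set"
  define w where "w z = (cis (fst z) + cis (snd z)) / complex_of_real r" for z :: "real \<times> real"
  define e where "e z = cis (- (real k1 * fst z + real k2 * snd z))" for z :: "real \<times> real"
  define S where "S M z = (\<Sum>m<M. w z^m)" for M z
  define L where "L z = 1 / (1 - w z)" for z
  have w_le: "norm (w z) \<le> 2 / r" for z
    using assms norm_cis_add_le by (simp add: w_def norm_divide divide_right_mono)
  have w_less: "norm (w z) < 1" for z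
  proof -
    have "2 / r < 1" using assms by simp
    then show ?thesis using w_le[of z] by linarith
  qed
  have S_lim: "uniform_limit ?B S L sequentially"
  proof -
    have "uniform_limit ?B (\<lambda>M z. \<Sum>m<M. w z^m) (\<lambda>z. \<Sum>m. w z^m) sequentially"
    proof (rule Weierstrass_m_test)
      show "norm (w z^m) \<le> (2 / r)^m" for m z
        by (simp add: norm_power power_mono w_le)
      show "summable (\<lambda>m. (2 / r)^m)" using assms by (intro summable_geometric) simp
    qed
    then show ?thesis by (simp add: S_def[abs_def] L_def[abs_def] suminf_geometric[OF w_less])
  qed
  have cont_w: "continuous_on A w" for A
    unfolding w_def using assms by (intro continuous_intros) auto
  have cont_e: "continuous_on A e" for A
    unfolding e_def by (intro continuous_intros)
  have cont_S: "continuous_on A (S M)" for A M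
    unfolding S_def by (intro continuous_intros cont_w)
  have cont_L: "continuous_on A L" for A
    unfolding L_def using w_less by (intro continuous_intros cont_w) (metis norm_one less_irrefl right_minus_eq)
  have bdd: "bounded (f ` ?B)" if "continuous_on ?B f" for f :: "real \<times> real \<Rightarrow> complex"
    using that by (intro compact_imp_bounded compact_continuous_image compact_cbox)
  have S'_lim: "uniform_limit ?B (\<lambda>M z. cnj (S M z)) (\<lambda>z. cnj (L z)) sequentially"
    using S_lim by (simp add: uniform_limit_iff dist_norm flip: complex_cnj_diff)
  have cnj_L: "continuous_on ?B (\<lambda>z. cnj (L z))"
    by (intro continuous_intros cont_L)
  have "uniform_limit ?B (\<lambda>M z. e z * (S M z * cnj (S M z))) (\<lambda>z. e z * (L z * cnj (L z))) sequentially"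
    by (intro uniform_lim_mult uniform_limit_const S_lim S'_lim bdd cont_e cont_L cnj_L continuous_intros)
  then obtain I J where IJ: "\<And>M. ((\<lambda>z. e z * (S M z * cnj (S M z))) has_integral I M) ?B"
      "((\<lambda>z. e z * (L z * cnj (L z))) has_integral J) ?B" "I \<longlonglongrightarrow> J"
    by (rule uniform_limit_integral_cbox)
       (auto intro!: continuous_intros cont_e cont_S)
  have J: "J / complex_of_real (4 * pi^2) = coef r (int k1) (int k2)"
  proof -
    have "e z * (L z * cnj (L z)) = (case z of (x, y) \<Rightarrow>
        exp (- \<i> * complex_of_real (of_int (int k1) * x + of_int (int k2) * y))
          / complex_of_real ((cmod (pol r (exp (\<i> * complex_of_real x)) (exp (\<i> * complex_of_real y))))\<^sup>2))" for z
    proof -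
      have e_exp: "e z = exp (- \<i> * complex_of_real (of_int (int k1) * fst z + of_int (int k2) * snd z))"
        by (simp add: e_def cis_conv_exp algebra_simps)
      have "pol r (exp (\<i> * complex_of_real (fst z))) (exp (\<i> * complex_of_real (snd z))) = 1 - w z"
        by (simp add: pol_def w_def cis_conv_exp)
      then show ?thesis
        using e_exp
        by (simp add: case_prod_beta L_def complex_norm_square del: of_real_power)
    qed
    then have "J = integral ?B (\<lambda>(x, y). exp (- \<i> * complex_of_real (of_int (int k1) * x + of_int (int k2) * y))
          / complex_of_real ((cmod (pol r (exp (\<i> * complex_of_real x)) (exp (\<i> * complex_of_real y))))\<^sup>2))"
      using integral_unique[OF IJ(2)] by simp
    then show ?thesis by (simp add: coef_def)
  qed
  let ?c = "\<lambda>n. real ((2 * n + k1 + k2) choose (n + k1)) / r^(2 * n + k1 + k2)"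
  \<comment> \<open>With both series cut off at \<open>M + (k1 + k2)\<close>, the surviving pairs
    satisfy \<open>m = n + k1 + k2\<close>, and \<open>m\<close> is below the cutoff exactly for
    \<open>n < M\<close>; hence the shift.\<close>
  have I: "I (M + (k1 + k2)) / complex_of_real (4 * pi^2) = (\<Sum>n<M. complex_of_real (?c n))" for M
  proof -
    let ?M = "M + (k1 + k2)"
    let ?g = "\<lambda>m n (x, y). cis (- (real k1 * x + real k2 * y)) * (cis x + cis y)^m * cnj (cis x + cis y)^n"
    have int: "?g m n integrable_on ?B" for m n
      unfolding case_prod_beta by (intro integrable_continuous continuous_intros)
    have "e z * (S ?M z * cnj (S ?M z))
        = (\<Sum>m<?M. \<Sum>n<?M. complex_of_real (1 / r^(m + n)) * ?g m n z)" for z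
      unfolding S_def cnj_sum
      by (subst sum_product, unfold sum_distrib_left, intro sum.cong refl)
         (simp add: e_def w_def case_prod_beta power_divide power_add)
    then have "I ?M = integral ?B (\<lambda>z. \<Sum>m<?M. \<Sum>n<?M. complex_of_real (1 / r^(m + n)) * ?g m n z)"
      using integral_unique[OF IJ(1)[of ?M]] by simp
    also have "\<dots> = (\<Sum>m<?M. \<Sum>n<?M. complex_of_real (1 / r^(m + n)) * integral ?B (?g m n))"
      by (rule integral_double_sum) (simp_all only: finite_lessThan int)
    also have "\<dots> = (\<Sum>n<?M. \<Sum>m<?M. complex_of_real (1 / r^(m + n)) * integral ?B (?g m n))"
      by (rule sum.swap)
    also have "\<dots> = (\<Sum>n<?M. \<Sum>m<?M. if m = n + k1 + k2 then complex_of_real (4 * pi^2 * ?c n) else 0)"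
      unfolding integral_torus_monomial by (intro sum.cong refl) (auto simp: mult_2 add_ac)
    also have "\<dots> = (\<Sum>n<?M. if n < M then complex_of_real (4 * pi^2 * ?c n) else 0)"
      by (intro sum.cong refl) auto
    also have "\<dots> = (\<Sum>n<M. complex_of_real (4 * pi^2 * ?c n))"
      by (rule sum.mono_neutral_cong_right) auto
    also have "\<dots> = (\<Sum>n<M. complex_of_real (?c n)) * complex_of_real (4 * pi^2)"
      unfolding sum_distrib_right by (intro sum.cong refl) (simp only: of_real_mult mult.commute)
    finally show ?thesis by simp
  qed
  have "(\<lambda>M. I (M + (k1 + k2)) / complex_of_real (4 * pi^2)) \<longlonglongrightarrow> J / complex_of_real (4 * pi^2)"
    using LIMSEQ_ignore_initial_segment[OF IJ(3), of "k1 + k2"] by (intro tendsto_divide tendsto_const) auto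
  then show ?thesis unfolding I J sums_def .
qed

section \<open>Asymptotics of the coefficients\<close>

text \<open>Two absorption identities, one for each of the two added steps, give the exact ratio of
  neighbouring diagonal coefficients.\<close>

lemma binomial_diagonal_step:
  "real (Suc a) * real (Suc b) * real (Suc (Suc (a + b)) choose Suc a)
     = real (Suc (Suc (a + b))) * real (Suc (a + b)) * real ((a + b) choose a)"
proof -
  have "Suc a * (Suc (Suc (a + b)) choose Suc a) = Suc (Suc (a + b)) * (Suc (a + b) choose a)"
    by (metis Suc_times_binomial_eq mult.commute)
  moreover have "Suc b * (Suc (a + b) choose a) = Suc (a + b) * ((a + b) choose a)"
  proof -
    have "Suc b * (Suc (b + a) choose Suc b) = Suc (b + a) * ((b + a) choose b)"
      by (metis Suc_times_binomial_eq mult.commute)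
    moreover have "Suc (b + a) choose Suc b = Suc (a + b) choose a" "(b + a) choose b = (a + b) choose a"
      using binomial_symmetric[of "Suc b" "Suc (b + a)"] binomial_symmetric[of b "b + a"]
      by (simp_all add: add.commute)
    ultimately show ?thesis by (simp add: add.commute)
  qed
  ultimately have "Suc a * Suc b * (Suc (Suc (a + b)) choose Suc a)
      = Suc (Suc (a + b)) * Suc (a + b) * ((a + b) choose a)"
    by (metis mult.assoc mult.left_commute)
  then show ?thesis by (metis of_nat_mult)
qed

section \<open>Case (i): the series relative to its first term\<close>

context split_weights begin

definition M :: real where "M = (real k1 + real k2)^2 / (real k1 * real k2)"

text \<open>The \<open>n\<close>-th summand of the coefficient series divided by the first, without
  its power of \<open>r\<close>.\<close>

definition binom_ratio :: "nat \<Rightarrow> nat \<Rightarrow> real" where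
  "binom_ratio n t = real ((2 * n + t * k1 + t * k2) choose (n + t * k1)) / real ((t * k1 + t * k2) choose (t * k1))"

lemma M_pos: "0 < M" using k1_pos k2_pos by (simp add: M_def)

lemma binom_ratio_0: "binom_ratio 0 t = 1"
  by (simp add: binom_ratio_def)

lemma binom_ratio_nonneg: "0 \<le> binom_ratio n t"
  by (simp add: binom_ratio_def)

lemma binom_ratio_Suc:
  "binom_ratio (Suc n) t = binom_ratio n t *
     ((2 * real n + 2 + real t * (real k1 + real k2)) * (2 * real n + 1 + real t * (real k1 + real k2))
      / ((real n + 1 + real t * real k1) * (real n + 1 + real t * real k2)))"
proof -
  let ?a = "n + t * k1" and ?b = "n + t * k2"
  have eq: "(2 * Suc n + t * k1 + t * k2) choose (Suc n + t * k1) = Suc (Suc (?a + ?b)) choose Suc ?a"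
      "(2 * n + t * k1 + t * k2) choose (n + t * k1) = (?a + ?b) choose ?a"
    by (rule arg_cong2[where f = "(choose)"]; simp)+
  have "real ((2 * Suc n + t * k1 + t * k2) choose (Suc n + t * k1))
      = real ((2 * n + t * k1 + t * k2) choose (n + t * k1)) *
       (real (Suc (Suc (?a + ?b))) * real (Suc (?a + ?b)) / (real (Suc ?a) * real (Suc ?b)))"
    unfolding eq using binomial_diagonal_step[of ?a ?b]
    by (simp add: nonzero_eq_divide_eq mult_ac del: of_nat_Suc binomial_Suc_Suc)
  moreover have "real (Suc (Suc (?a + ?b))) = 2 * real n + 2 + real t * (real k1 + real k2)"
      "real (Suc (?a + ?b)) = 2 * real n + 1 + real t * (real k1 + real k2)"
      "real (Suc ?a) = real n + 1 + real t * real k1" "real (Suc ?b) = real n + 1 + real t * real k2"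
    by (simp_all add: algebra_simps)
  ultimately show ?thesis unfolding binom_ratio_def by (simp only: times_divide_eq_left)
qed

text \<open>Dropping the \<open>- 1\<close> from \<open>u + v - 1\<close>, the claim becomes
  \<open>(u + v)^2 \<le> M * (u * v)\<close>. After clearing denominators the gap factors as
  \<open>(k1 - k2)^2\<close> times a nonnegative term.\<close>

lemma binom_ratio_step_le:
  "(2 * real n + 2 + real t * (real k1 + real k2)) * (2 * real n + 1 + real t * (real k1 + real k2))
      / ((real n + 1 + real t * real k1) * (real n + 1 + real t * real k2)) \<le> M"
proof -
  define c where "c = real n + 1"
  define u v where "u = c + real t * real k1" and "v = c + real t * real k2"
  have pos: "0 < u" "0 < v" "0 < c" by (auto simp: u_def v_def c_def add_pos_nonneg)
  have "(real k1 + real k2)^2 * (u * v) - real k1 * real k2 * (u + v)^2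
      = (real k1 * v - real k2 * u) * (real k1 * u - real k2 * v)"
    by (simp add: power2_eq_square algebra_simps)
  also have "\<dots> = (real k1 - real k2)^2 * (c * (c + real t * (real k1 + real k2)))"
    by (simp add: u_def v_def power2_eq_square algebra_simps)
  also have "\<dots> \<ge> 0" using pos by (intro mult_nonneg_nonneg add_nonneg_nonneg) auto
  finally have "(u + v)^2 \<le> M * (u * v)"
    using k1_pos k2_pos unfolding M_def by (simp add: field_simps)
  moreover have "(u + v) * (u + v - 1) \<le> (u + v)^2"
    using pos by (simp add: power2_eq_square algebra_simps)
  ultimately have "(u + v) * (u + v - 1) / (u * v) \<le> M"
    using pos by (subst pos_divide_le_eq) auto
  then show ?thesis by (simp add: u_def v_def c_def algebra_simps)
qed

lemma binom_ratio_step_tendsto: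
  "(\<lambda>t. (2 * real n + 2 + real t * (real k1 + real k2)) * (2 * real n + 1 + real t * (real k1 + real k2))
      / ((real n + 1 + real t * real k1) * (real n + 1 + real t * real k2))) \<longlonglongrightarrow> M"
proof -
  have "((\<lambda>t::nat. (a + real t * K) * (b + real t * K) / ((c + real t * x) * (c + real t * y))) \<longlonglongrightarrow> K * K * (inverse x * inverse y))"
    if "0 < x" "0 < y" "0 < K" "0 < c" for a b c x y K :: real
    using that by real_asymp
  from this[of "real k1" "real k2" "real k1 + real k2" "real n + 1" "2 * real n + 2" "2 * real n + 1"]
  have "(\<lambda>t. (2 * real n + 2 + real t * (real k1 + real k2)) * (2 * real n + 1 + real t * (real k1 + real k2))
      / ((real n + 1 + real t * real k1) * (real n + 1 + real t * real k2))) \<longlonglongrightarrow>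
        (real k1 + real k2) * (real k1 + real k2) * (inverse (real k1) * inverse (real k2))"
    using k1_pos k2_pos by simp
  also have "(real k1 + real k2) * (real k1 + real k2) * (inverse (real k1) * inverse (real k2)) = M"
    by (simp add: M_def power2_eq_square divide_inverse)
  finally show ?thesis .
qed

lemma binom_ratio_le: "binom_ratio n t \<le> M^n"
proof (induction n)
  case (Suc n)
  show ?case unfolding binom_ratio_Suc power_Suc2
    by (rule mult_mono[OF Suc binom_ratio_step_le]) (use M_pos in \<open>auto intro!: divide_nonneg_nonneg\<close>)
qed (simp add: binom_ratio_0)

lemma binom_ratio_tendsto: "(\<lambda>t. binom_ratio n t) \<longlonglongrightarrow> M^n"
proof (induction n)
  case (Suc n)
  show ?case unfolding binom_ratio_Suc power_Suc2
    by (rule tendsto_mult[OF Suc binom_ratio_step_tendsto])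
qed (simp add: binom_ratio_0)

definition R :: "nat \<Rightarrow> real \<Rightarrow> real" where
  "R t r = (\<Sum>n. binom_ratio n t / r^(2 * n))"

lemma M_power_divide: "M^n / r^(2 * n) = (M / r^2)^n"
  by (simp add: power_divide power_mult)

lemma summable_M:
  assumes "M / r^2 < 1"
  shows "summable (\<lambda>n. M^n / r^(2 * n))"
  unfolding M_power_divide using assms M_pos by (intro summable_geometric) simp

lemma summable_R:
  assumes "M / r^2 < 1"
  shows "summable (\<lambda>n. binom_ratio n t / r^(2 * n))"
proof (rule summable_comparison_test'[OF summable_M[OF assms], of 0])
  fix n :: nat
  show "norm (binom_ratio n t / r^(2 * n)) \<le> M^n / r^(2 * n)"
    using binom_ratio_le binom_ratio_nonneg by (simp add: divide_right_mono power_mult)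
qed

lemma suminf_M:
  assumes "M / r^2 < 1"
  shows "(\<Sum>n. M^n / r^(2 * n)) = 1 / (1 - M / r^2)"
  unfolding M_power_divide using assms M_pos by (intro suminf_geometric) simp

text \<open>Tannery's theorem: the terms converge to those of a geometric series that also dominates
  them for every \<open>t\<close>.\<close>

lemma R_tendsto:
  assumes "M / r^2 < 1"
  shows "(\<lambda>t. R t r) \<longlonglongrightarrow> 1 / (1 - M / r^2)"
proof -
  have "eventually (\<lambda>t. summable (\<lambda>n. norm (binom_ratio n t / r^(2 * n)))) sequentially \<and>
      summable (\<lambda>n. norm (M^n / r^(2 * n))) \<and>
      (\<lambda>t. \<Sum>n. binom_ratio n t / r^(2 * n)) \<longlonglongrightarrow> (\<Sum>n. M^n / r^(2 * n))"
  proof (rule tannerys_theorem[OF _ _ summable_M[OF assms]])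
    show "(\<lambda>t. binom_ratio n t / r^(2 * n)) \<longlonglongrightarrow> M^n / r^(2 * n)" for n
      unfolding divide_inverse by (intro tendsto_mult_right binom_ratio_tendsto)
    show "\<forall>\<^sub>F (n, t) in sequentially \<times>\<^sub>F sequentially. norm (binom_ratio n t / r^(2 * n)) \<le> M^n / r^(2 * n)"
      using binom_ratio_le binom_ratio_nonneg
      by (intro always_eventually) (auto simp: divide_right_mono power_mult)
  qed simp
  then show ?thesis by (simp add: R_def suminf_M[OF assms])
qed

lemma R_error:
  assumes "M / r^2 < 1"
  shows "(\<lambda>n. (M^n - binom_ratio n t) / r^(2 * n)) sums (1 / (1 - M / r^2) - R t r)"
  unfolding diff_divide_distrib R_def suminf_M[OF assms, symmetric]
  using assms by (intro sums_diff summable_sums summable_M summable_R)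

text \<open>The error is a series of nonnegative terms, each decreasing in \<open>r\<close>, so the
  error at the left end of a half-line bounds all others.\<close>

lemma R_error_antimono:
  assumes "M / r0^2 < 1" "0 < r0" "r0 \<le> r"
  shows "M / r^2 < 1" "\<bar>R t r - 1 / (1 - M / r^2)\<bar> \<le> \<bar>R t r0 - 1 / (1 - M / r0^2)\<bar>"
proof -
  have "M / r^2 \<le> M / r0^2"
    using assms M_pos by (intro divide_left_mono power_mono) auto
  then show r: "M / r^2 < 1" using assms by linarith
  have nonneg: "0 \<le> M^n - binom_ratio n t" for n using binom_ratio_le by simp
  have "0 \<le> 1 / (1 - M / r^2) - R t r"
    by (rule sums_le[OF _ sums_zero R_error[OF r]]) (use nonneg assms in simp)
  moreover have "1 / (1 - M / r^2) - R t r \<le> 1 / (1 - M / r0^2) - R t r0"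
    by (rule sums_le[OF _ R_error[OF r] R_error[OF assms(1)]])
       (use nonneg assms in \<open>auto intro!: divide_left_mono power_mono\<close>)
  ultimately show "\<bar>R t r - 1 / (1 - M / r^2)\<bar> \<le> \<bar>R t r0 - 1 / (1 - M / r0^2)\<bar>" by linarith
qed

lemma uniform_limit_R:
  assumes "M / r0^2 < 1" "0 < r0"
  shows "uniform_limit {r0..} R (\<lambda>r. 1 / (1 - M / r^2)) sequentially"
  unfolding uniform_limit_iff
proof (intro allI impI)
  fix e :: real assume "0 < e"
  then have "\<forall>\<^sub>F t in sequentially. dist (R t r0) (1 / (1 - M / r0^2)) < e"
    by (intro tendstoD[OF R_tendsto[OF assms(1)]])
  then show "\<forall>\<^sub>F t in sequentially. \<forall>r\<in>{r0..}. dist (R t r) (1 / (1 - M / r^2)) < e"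
    by eventually_elim (auto simp only: dist_real_def atLeast_iff intro: le_less_trans[OF R_error_antimono(2)[OF assms]])
qed

abbreviation scaled_coef :: "nat \<Rightarrow> real \<Rightarrow> complex" where
  "scaled_coef t r \<equiv> complex_of_real (sqrt (real t) *
            (r powr (real k1 + real k2) * real k1 ^ k1 * real k2 ^ k2
             / (real k1 + real k2) ^ (k1 + k2)) ^ t)
           * coef r (int (t * k1)) (int (t * k2))"

text \<open>The prefactor turns the first summand of the series into the binomial probability at the
  mean; what remains is \<open>R\<close>.\<close>

lemma scaled_coef_eq:
  assumes "r > 2" "M / r^2 < 1"
  shows "scaled_coef t r = complex_of_real (sqrt (real t) * Bernstein (t * (k1 + k2)) (t * k1) P * R t r)"
proof -
  let ?C = "real ((t * k1 + t * k2) choose (t * k1))"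
  have C: "?C \<noteq> 0" by simp
  have "(\<lambda>n. ?C / r^(t * k1 + t * k2) * (binom_ratio n t / r^(2 * n))) sums (?C / r^(t * k1 + t * k2) * R t r)"
    unfolding R_def by (intro sums_mult summable_sums summable_R assms)
  moreover have "?C / r^(t * k1 + t * k2) * (binom_ratio n t / r^(2 * n))
      = real ((2 * n + t * k1 + t * k2) choose (n + t * k1)) / r^(2 * n + t * k1 + t * k2)" for n
    using C assms unfolding binom_ratio_def by (simp add: power_add mult_ac)
  ultimately have "(\<lambda>n. complex_of_real (real ((2 * n + t * k1 + t * k2) choose (n + t * k1)) / r^(2 * n + t * k1 + t * k2)))
      sums complex_of_real (?C / r^(t * k1 + t * k2) * R t r)"
    by (simp only: sums_of_real)
  with coef_sums[OF assms(1), of "t * k1" "t * k2"]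
  have coef: "coef r (int (t * k1)) (int (t * k2)) = complex_of_real (?C / r^(t * k1 + t * k2) * R t r)"
    by (rule sums_unique2)
  have pw: "r powr (real k1 + real k2) = r^(k1 + k2)"
    using assms by (simp add: powr_realpow flip: of_nat_add)
  have "(r^(k1 + k2) * real k1 ^ k1 * real k2 ^ k2 / (real k1 + real k2) ^ (k1 + k2)) ^ t * (?C / r^(t * k1 + t * k2))
      = Bernstein (t * (k1 + k2)) (t * k1) P"
  proof -
    have e: "t * (k1 + k2) - t * k1 = t * k2" "t * (k1 + k2) = t * k1 + t * k2" by (simp_all add: algebra_simps)
    have K: "real k1 + real k2 = K" by (simp add: K_def)
    show ?thesis
      unfolding Bernstein_def e PQ(1) unfolding P_def Q_def K
      using assms K_pos
      by (simp add: power_divide power_mult_distrib power_add power_mult[symmetric] mult.commute[of t])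
  qed
  then have "sqrt (real t) * (r powr (real k1 + real k2) * real k1 ^ k1 * real k2 ^ k2
             / (real k1 + real k2) ^ (k1 + k2)) ^ t * (?C / r^(t * k1 + t * k2) * R t r)
      = sqrt (real t) * Bernstein (t * (k1 + k2)) (t * k1) P * R t r"
    unfolding pw by (metis (no_types, lifting) mult.assoc)
  then show ?thesis unfolding coef by (metis of_real_mult)
qed

text \<open>The peak probability does not depend on \<open>r\<close>, so uniformity comes from
  \<open>R\<close>; multiplying the two limits needs the limit of \<open>R\<close> bounded on the
  half-line.\<close>

lemma subcritical_uniform_limit:
  assumes "r0 > 2" "M / r0^2 < 1"
  shows "uniform_limit {r0..} scaled_coef
    (\<lambda>r. complex_of_real (1 / sqrt (2 * pi) * sqrt ((real k1 + real k2) / (real k1 * real k2))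
                * (1 / (1 - M / r^2)))) sequentially"
proof -
  let ?S = "1 / sqrt (2 * pi) * sqrt ((real k1 + real k2) / (real k1 * real k2))"
  have S: "uniform_limit {r0..} (\<lambda>t r. sqrt (real t) * Bernstein (t * (k1 + k2)) (t * k1) P) (\<lambda>r. ?S) sequentially"
    using Bernstein_peak_tendsto unfolding of_nat_add
    by (auto simp: uniform_limit_iff tendsto_iff elim!: eventually_mono)
  have bdd: "bounded ((\<lambda>r. 1 / (1 - M / r^2)) ` {r0..})"
  proof (rule boundedI)
    fix y assume "y \<in> (\<lambda>r. 1 / (1 - M / r^2)) ` {r0..}"
    then obtain r where r: "r0 \<le> r" "y = 1 / (1 - M / r^2)" by auto
    have "M / r^2 \<le> M / r0^2"
      using r assms M_pos by (intro divide_left_mono power_mono) auto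
    then have "0 < 1 - M / r0^2" "1 - M / r0^2 \<le> 1 - M / r^2" "0 < 1 - M / r^2"
      using assms(2) by linarith+
    moreover from this have "1 / (1 - M / r^2) \<le> 1 / (1 - M / r0^2)"
      by (intro frac_le) auto
    ultimately have "\<bar>1 / (1 - M / r^2)\<bar> \<le> 1 / (1 - M / r0^2)" by simp
    then show "norm y \<le> 1 / (1 - M / r0^2)" unfolding r by (simp only: real_norm_def)
  qed
  have "uniform_limit {r0..} (\<lambda>t r. sqrt (real t) * Bernstein (t * (k1 + k2)) (t * k1) P * R t r)
      (\<lambda>r. ?S * (1 / (1 - M / r^2))) sequentially"
    by (rule uniform_lim_mult[OF S uniform_limit_R _ bdd]) (use assms in \<open>auto simp: image_constant_conv\<close>)
  then have lim: "uniform_limit {r0..} (\<lambda>t r. complex_of_real (sqrt (real t) * Bernstein (t * (k1 + k2)) (t * k1) P * R t r))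
      (\<lambda>r. complex_of_real (?S * (1 / (1 - M / r^2)))) sequentially"
    by (rule bounded_linear.uniform_limit[OF bounded_linear_of_real])
  show ?thesis
  proof (rule uniform_limit_cong'[THEN iffD2, OF _ _ lim])
    fix t r assume "r \<in> {r0..}"
    then show "scaled_coef t r = complex_of_real (sqrt (real t) * Bernstein (t * (k1 + k2)) (t * k1) P * R t r)"
      using assms R_error_antimono(1)[of r0 r] by (intro scaled_coef_eq) auto
  qed simp
qed

end

section \<open>Random-walk form of the normalised coefficients\<close>

definition up_prob :: "real \<Rightarrow> real" where
  "up_prob r = (1 + sqrt (1 - 4 / r^2)) / 2"

lemma up_prob:
  assumes "r > 2"
  shows "1 / 2 < up_prob r" "up_prob r < 1" "up_prob r * (1 - up_prob r) = 1 / r^2"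
    "2 * up_prob r - 1 = sqrt (1 - 4 / r^2)"
    "r / 2 - sqrt (r^2 / 4 - 1) = r * (1 - up_prob r)"
proof -
  have r4: "4 < r^2" using power_strict_mono[of 2 r 2] assms by simp
  then have s: "0 < 1 - 4 / r^2" "1 - 4 / r^2 < 1" using assms by (auto simp: field_simps)
  show "1 / 2 < up_prob r" using s by (simp add: up_prob_def)
  have "sqrt (1 - 4 / r^2) < 1" using s by simp
  then show "up_prob r < 1" by (simp add: up_prob_def)
  have "up_prob r * (1 - up_prob r) = (1 - sqrt (1 - 4 / r^2) ^ 2) / 4"
    by (simp add: up_prob_def power2_eq_square field_simps)
  then show "up_prob r * (1 - up_prob r) = 1 / r^2" using s by simp
  show "2 * up_prob r - 1 = sqrt (1 - 4 / r^2)"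
    by (simp add: up_prob_def add_divide_distrib distrib_left)
  have "sqrt (r^2 / 4 - 1) = sqrt ((r / 2)^2 * (1 - 4 / r^2))"
    using assms by (simp add: power_divide field_simps)
  also have "\<dots> = r / 2 * sqrt (1 - 4 / r^2)" using assms by (simp add: real_sqrt_mult)
  finally show "r / 2 - sqrt (r^2 / 4 - 1) = r * (1 - up_prob r)"
    by (simp add: up_prob_def algebra_simps diff_divide_distrib add_divide_distrib)
qed

lemma up_prob_mono: "2 < r \<Longrightarrow> r \<le> r' \<Longrightarrow> up_prob r \<le> up_prob r'"
  unfolding up_prob_def by (auto intro!: divide_left_mono power_mono mult_pos_pos)

text \<open>Each normalised summand is the probability of being at level \<open>k1 - k2\<close> at
  time \<open>2 * (n + k2) + (k1 - k2)\<close>. The series is therefore the tail, from index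
  \<open>k2\<close> on, of the total computed in \<open>Bernstein_diagonal_sums\<close>.\<close>

lemma normalised_coef_eq:
  assumes "r > 2" "k2 \<le> k1"
  shows "coef r (int k1) (int k2) / complex_of_real ((r / 2 - sqrt (r^2 / 4 - 1))^(k1 - k2))
    = complex_of_real (1 / (2 * up_prob r - 1)
        - (\<Sum>j<k2. Bernstein (2 * j + (k1 - k2)) (j + (k1 - k2)) (up_prob r)))"
proof -
  define p where "p = up_prob r"
  note p = up_prob[OF assms(1), folded p_def]
  define d where "d = k1 - k2"
  have term_eq: "real ((2 * n + k1 + k2) choose (n + k1)) / r^(2 * n + k1 + k2) / (r * (1 - p))^d
      = Bernstein (2 * (n + k2) + d) (n + k2 + d) p" for n
  proof -
    have e: "2 * n + k1 + k2 = 2 * (n + k2) + d" "n + k1 = n + k2 + d" "2 * (n + k2) + d - (n + k2 + d) = n + k2"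
      using assms by (auto simp: d_def)
    have r2: "1 / r^2 = p * (1 - p)" and p': "1 / (r * (r * (1 - p))) = p"
      using p assms by (auto simp: field_simps power2_eq_square)
    have "1 / (r^(2 * (n + k2) + d) * (r * (1 - p))^d) = (1 / r^2)^(n + k2) * (1 / (r * (r * (1 - p))))^d"
      by (simp add: power_add power_mult power_divide power_mult_distrib)
    also have "\<dots> = p^(n + k2 + d) * (1 - p)^(n + k2)"
      unfolding r2 p' by (simp add: power_add power_mult_distrib)
    finally show ?thesis unfolding Bernstein_def e by (simp add: divide_inverse)
  qed
  have x: "r / 2 - sqrt (r^2 / 4 - 1) = r * (1 - p)" by (rule p)
  have "(\<lambda>n. Bernstein (2 * (n + k2) + d) (n + k2 + d) p)
      sums (1 / (2 * p - 1) - (\<Sum>j<k2. Bernstein (2 * j + d) (j + d) p))"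
    by (rule sums_split_initial_segment[OF Bernstein_diagonal_sums[OF p(1,2)]])
  then have "(\<lambda>n. complex_of_real (Bernstein (2 * (n + k2) + d) (n + k2 + d) p))
      sums complex_of_real (1 / (2 * p - 1) - (\<Sum>j<k2. Bernstein (2 * j + d) (j + d) p))"
    by (simp only: sums_of_real)
  moreover have "(\<lambda>n. complex_of_real (Bernstein (2 * (n + k2) + d) (n + k2 + d) p))
      sums (coef r (int k1) (int k2) / complex_of_real ((r * (1 - p))^d))"
    using sums_divide[OF coef_sums[OF assms(1), of k1 k2], of "complex_of_real ((r * (1 - p))^d)"]
    by (simp only: of_real_divide[symmetric] term_eq)
  ultimately show ?thesis unfolding x d_def[symmetric] p_def[symmetric] by (rule sums_unique2[symmetric])
qed

section \<open>Cases (ii) and (iii): at and before the hitting time\<close>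

context split_weights begin

abbreviation normalised_coef :: "nat \<Rightarrow> real \<Rightarrow> complex" where
  "normalised_coef t r \<equiv> coef r (int (t * k1)) (int (t * k2))
            / complex_of_real ((r / 2 - sqrt (r^2 / 4 - 1)) ^ (t * (k1 - k2)))"

lemma normalised_coef_scaled:
  assumes "r > 2" "k2 \<le> k1"
  shows "normalised_coef t r = complex_of_real (1 / (2 * up_prob r - 1)
    - (\<Sum>j<t * k2. Bernstein (2 * j + t * (k1 - k2)) (j + t * (k1 - k2)) (up_prob r)))"
  using normalised_coef_eq[OF assms(1), of "t * k2" "t * k1"] assms(2)
  by (simp add: right_diff_distrib')

text \<open>Since \<open>M = 1 / (P * Q)\<close>, the quotient compares \<open>x * (1 - x)\<close>
  at \<open>up_prob r\<close> and at \<open>P\<close>. Both points are at least 1/2, where this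
  function strictly decreases.\<close>

lemma up_prob_vs_P:
  assumes "r > 2" "k2 \<le> k1"
  shows "M / r^2 = 1 \<Longrightarrow> up_prob r = P" "M / r^2 > 1 \<Longrightarrow> up_prob r < P"
proof -
  let ?p = "up_prob r"
  have "real k1 \<ge> K / 2" using assms by (simp add: K_def)
  then have "P \<ge> 1 / 2" using K_pos by (simp add: P_def field_simps)
  then have neg: "1 - ?p - P < 0" using up_prob(1)[OF assms(1)] by simp
  have "M = 1 / (P * Q)"
    using K_pos by (simp add: M_def P_def Q_def K_def power2_eq_square)
  then have M: "M / r^2 = ?p * (1 - ?p) / (P * Q)" using up_prob(3)[OF assms(1)] by simp
  have PQ_pos: "0 < P * Q" using P_pos Q_pos by simp
  have diff: "?p * (1 - ?p) - P * Q = (?p - P) * (1 - ?p - P)"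
    by (simp add: PQ(1)[symmetric] algebra_simps)
  show "?p = P" if "M / r^2 = 1"
  proof -
    have "?p * (1 - ?p) = P * Q" using that PQ_pos unfolding M by (simp add: field_simps)
    then show ?thesis using diff neg by simp
  qed
  show "?p < P" if "M / r^2 > 1"
  proof -
    have "P * Q < ?p * (1 - ?p)" using that PQ_pos unfolding M by (simp add: field_simps)
    then have "0 < (?p - P) * (1 - ?p - P)" using diff by simp
    then show ?thesis using neg by (simp add: zero_less_mult_iff)
  qed
qed

text \<open>By \<open>sum_Bernstein_diagonal\<close> the normalised coefficient is a distribution
  function at its mean plus a reflected tail, over the drift. The first tends to 1/2, and the tail
  is at most a constant times the peak probability, which tends to 0.\<close>

lemma critical_limit:
  assumes "r > 2" "k2 \<le> k1" "M / r^2 = 1"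
  shows "(\<lambda>t. normalised_coef t r) \<longlonglongrightarrow> complex_of_real (1 / (2 * sqrt (1 - 4 / r^2)))"
proof -
  have pP: "up_prob r = P" using up_prob_vs_P(1)[OF assms] .
  note p = up_prob[OF assms(1), unfolded pP]
  have P: "0 < P" "P < 1" using p by auto
  define b where "b t = Bernstein (t * (k1 + k2)) (t * k1) P" for t
  define tail where "tail t = (P / (1 - P))^(t * (k1 - k2)) * (1 - bin_cdf (t * (k1 + k2)) (t * k1) (1 - P))" for t
  have e: "2 * (t * k2) + t * (k1 - k2) = t * (k1 + k2)" "t * k2 + t * (k1 - k2) = t * k1" for t
    using assms(2) by (auto simp: right_diff_distrib' distrib_left)
  have "(\<lambda>t. (sqrt (real t) * b t) * (1 / sqrt (real t))) \<longlonglongrightarrow>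
      (1 / sqrt (2 * pi) * sqrt (real (k1 + k2) / (real k1 * real k2))) * 0"
    unfolding b_def by (rule tendsto_mult[OF Bernstein_peak_tendsto]) real_asymp
  moreover have "\<forall>\<^sub>F t in sequentially. (sqrt (real t) * b t) * (1 / sqrt (real t)) = b t"
    using eventually_gt_at_top[of 0] by eventually_elim simp
  ultimately have b: "b \<longlonglongrightarrow> 0" by (simp add: tendsto_cong)
  have "tail \<longlonglongrightarrow> 0"
  proof (rule tendsto_sandwich[OF always_eventually always_eventually tendsto_const])
    show "\<forall>t. 0 \<le> tail t"
      unfolding tail_def using P by (subst one_minus_bin_cdf) (auto intro!: mult_nonneg_nonneg sum_nonneg Bernstein_nonneg)
    show "\<forall>t. tail t \<le> b t * (P / (2 * P - 1))"
      using bin_cdf_tail_le[of P "t * (k1 - k2)" "t * k2" for t] p P unfolding tail_def b_def e by auto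
    show "(\<lambda>t. b t * (P / (2 * P - 1))) \<longlonglongrightarrow> 0"
      using tendsto_mult_right[OF b, of "P / (2 * P - 1)"] by simp
  qed
  \<comment> \<open>The known limit 1/2 is for one trial more; the correction is \<open>P\<close>
    times the vanishing peak probability.\<close>
  moreover have "(\<lambda>t. bin_cdf (t * (k1 + k2)) (t * k1) P) \<longlonglongrightarrow> 1 / 2"
    using tendsto_add[OF bin_cdf_tendsto_half tendsto_mult_left[OF b, of P]]
    by (simp add: bin_cdf_Suc_trials b_def)
  ultimately have "(\<lambda>t. (bin_cdf (t * (k1 + k2)) (t * k1) P + tail t) / (2 * P - 1)) \<longlonglongrightarrow> (1 / 2 + 0) / (2 * P - 1)"
    using p by (intro tendsto_intros) auto
  moreover have "normalised_coef t r = complex_of_real ((bin_cdf (t * (k1 + k2)) (t * k1) P + tail t) / (2 * P - 1))" for t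
  proof -
    have "(2 * P - 1) * (\<Sum>j<t * k2. Bernstein (2 * j + t * (k1 - k2)) (j + t * (k1 - k2)) P)
        = 1 - bin_cdf (t * (k1 + k2)) (t * k1) P - tail t"
      using sum_Bernstein_diagonal[OF P, of "t * (k1 - k2)" "t * k2"] unfolding e tail_def .
    then have "1 / (2 * P - 1) - (\<Sum>j<t * k2. Bernstein (2 * j + t * (k1 - k2)) (j + t * (k1 - k2)) P)
        = (bin_cdf (t * (k1 + k2)) (t * k1) P + tail t) / (2 * P - 1)"
      using p(1) by (simp add: field_simps)
    then show ?thesis using normalised_coef_scaled[OF assms(1,2), of t] pP by simp
  qed
  ultimately have "(\<lambda>t. normalised_coef t r) \<longlonglongrightarrow> complex_of_real ((1 / 2 + 0) / (2 * P - 1))"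
    by (simp only: tendsto_of_real_iff)
  then show ?thesis unfolding p(4) by simp
qed

text \<open>Change of measure from \<open>p\<close> to \<open>P\<close>: for visits before time
  \<open>t * (k1 + k2)\<close> the likelihood ratio is at most \<open>\<theta>^t\<close>, and under
  \<open>P\<close> the expected total number of visits is \<open>1 / (2 * P - 1)\<close>.\<close>

lemma head_le:
  assumes "k2 \<le> k1" "1 / 2 < p" "p < P"
  shows "(\<Sum>j<t * k2. Bernstein (2 * j + t * (k1 - k2)) (j + t * (k1 - k2)) p)
    \<le> exp (- (K / (2 * P)) * (P - p)^2)^t / (2 * P - 1)"
proof -
  interpret swap: split_weights k2 k1 by (rule split_weights_swap(1)) unfold_locales
  note sw = split_weights_swap(2-)[OF split_weights_axioms]
  let ?D = "t * (k1 - k2)"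
  define \<theta> where "\<theta> = (p / P)^k1 * ((1 - p) / Q)^k2"
  have P: "1 / 2 < P" "P < 1" using assms PQ Q_pos by auto
  have \<theta>: "0 \<le> \<theta>" "\<theta> \<le> exp (- (K / (2 * P)) * (P - p)^2)"
  proof -
    show "0 \<le> \<theta>" using assms P Q_pos by (auto simp: \<theta>_def)
    \<comment> \<open>\<open>g_le\<close> covers arguments above the peak only, while
      \<open>p\<close> lies below \<open>P\<close>; so it is applied at \<open>1 - p\<close>, above
      \<open>Q\<close>, with the weights exchanged.\<close>
    have "swap.g 1 (1 - p) = \<theta>" by (simp add: swap.g_def sw \<theta>_def mult.commute)
    moreover have "swap.g 1 (1 - p) \<le> exp (- (real 1 * K / (2 * P)) * (1 - p - Q)^2)"
      using swap.g_le[of "1 - p" 1] assms P PQ(1) unfolding sw by linarith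
    moreover have "1 - p - Q = P - p" using PQ by linarith
    ultimately show "\<theta> \<le> exp (- (K / (2 * P)) * (P - p)^2)" by simp
  qed
  have "p * (1 - p) - P * (1 - P) = (p - P) * (1 - p - P)" by (simp add: algebra_simps)
  moreover have "(p - P) * (1 - p - P) \<ge> 0" using assms P by (intro mult_nonpos_nonpos) auto
  ultimately have pP: "P * Q \<le> p * (1 - p)" by (simp add: PQ)
  have term_le: "Bernstein (2 * j + ?D) (j + ?D) p \<le> \<theta>^t * Bernstein (2 * j + ?D) (j + ?D) P" if "j < t * k2" for j
  proof -
    define i where "i = t * k2 - j"
    have e: "2 * j + ?D - (j + ?D) = j" by simp
    have k: "t * k1 = j + ?D + i" "t * k2 = j + i"
      using that mult_le_mono2[OF assms(1), of t] diff_mult_distrib2[of t k1 k2]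
      unfolding i_def by linarith+
    have "\<theta>^t = (p / P)^(t * k1) * ((1 - p) / Q)^(t * k2)"
      by (simp add: \<theta>_def power_mult_distrib power_mult[symmetric] mult.commute)
    also have "\<dots> = (p / P)^(j + ?D) * ((1 - p) / Q)^j * ((p * (1 - p)) / (P * Q))^i"
      unfolding k by (simp add: power_add power_divide power_mult_distrib mult_ac)
    \<comment> \<open>Each of the \<open>i\<close> up-down pairs missing from the shorter path
      contributes a factor of at least 1.\<close>
    also have "\<dots> \<ge> (p / P)^(j + ?D) * ((1 - p) / Q)^j * 1"
      using assms P P_pos Q_pos pP by (intro mult_left_mono one_le_power) auto
    finally have "(p / P)^(j + ?D) * ((1 - p) / Q)^j * (P^(j + ?D) * Q^j) \<le> \<theta>^t * (P^(j + ?D) * Q^j)"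
      using P_pos Q_pos by (intro mult_right_mono) auto
    moreover have "(p / P)^(j + ?D) * ((1 - p) / Q)^j * (P^(j + ?D) * Q^j) = p^(j + ?D) * (1 - p)^j"
      using P_pos Q_pos by (simp add: power_divide)
    ultimately have "p^(j + ?D) * (1 - p)^j \<le> \<theta>^t * (P^(j + ?D) * Q^j)" by simp
    from mult_left_mono[OF this, of "real ((2 * j + ?D) choose (j + ?D))"]
    show ?thesis unfolding Bernstein_def e PQ(1) by (simp add: mult_ac)
  qed
  have "(\<Sum>j<t * k2. Bernstein (2 * j + ?D) (j + ?D) p)
      \<le> \<theta>^t * (\<Sum>j<t * k2. Bernstein (2 * j + ?D) (j + ?D) P)"
    unfolding sum_distrib_left by (intro sum_mono term_le) auto
  also have "\<dots> \<le> \<theta>^t * (1 / (2 * P - 1))"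
  proof (rule mult_left_mono)
    show "(\<Sum>j<t * k2. Bernstein (2 * j + ?D) (j + ?D) P) \<le> 1 / (2 * P - 1)"
      unfolding sums_unique[OF Bernstein_diagonal_sums[OF P, of ?D]]
      using P by (intro sum_le_suminf Bernstein_nonneg sums_summable[OF Bernstein_diagonal_sums]) auto
  qed (use \<theta> in simp)
  also have "\<dots> \<le> exp (- (K / (2 * P)) * (P - p)^2)^t * (1 / (2 * P - 1))"
    using \<theta> P by (intro mult_right_mono power_mono) auto
  finally show ?thesis by simp
qed

text \<open>The error is exactly the head of the visit series. Its bound grows with
  \<open>up_prob r\<close>, hence is worst at \<open>r1\<close>, and stays uniform down to
  \<open>r = 2\<close> although the limit itself blows up there.\<close>

lemma supercritical_uniform_limit:
  assumes "k2 \<le> k1" "r1 > 2" "M / r1^2 > 1"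
  shows "uniform_limit {2<..r1} normalised_coef (\<lambda>r. complex_of_real (1 / sqrt (1 - 4 / r^2))) sequentially"
proof -
  let ?\<theta> = "exp (- (K / (2 * P)) * (P - up_prob r1)^2)"
  have P1: "up_prob r1 < P" using up_prob_vs_P(2)[OF assms(2,1,3)] .
  have P: "1 / 2 < P" using P1 up_prob(1)[OF assms(2)] by simp
  have "?\<theta> < 1" using K_pos P P1 by simp
  then have lim: "(\<lambda>t. ?\<theta>^t / (2 * P - 1)) \<longlonglongrightarrow> 0"
    using tendsto_divide_zero[OF LIMSEQ_realpow_zero[of ?\<theta>]] by simp
  have le: "norm (normalised_coef t r - complex_of_real (1 / sqrt (1 - 4 / r^2))) \<le> ?\<theta>^t / (2 * P - 1)"
    if r: "r \<in> {2<..r1}" for t r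
  proof -
    let ?p = "up_prob r"
    let ?h = "\<Sum>j<t * k2. Bernstein (2 * j + t * (k1 - k2)) (j + t * (k1 - k2)) ?p"
    have r2: "r > 2" using r by simp
    have p: "1 / 2 < ?p" "?p \<le> up_prob r1" using up_prob[OF r2] up_prob_mono[OF r2] r by auto
    have "normalised_coef t r - complex_of_real (1 / sqrt (1 - 4 / r^2)) = complex_of_real (- ?h)"
      unfolding normalised_coef_scaled[OF r2 assms(1)] up_prob(4)[OF r2] by simp
    moreover have "0 \<le> ?h" using up_prob[OF r2] by (intro sum_nonneg Bernstein_nonneg) auto
    ultimately have "norm (normalised_coef t r - complex_of_real (1 / sqrt (1 - 4 / r^2))) = ?h"
      by (simp only: norm_of_real)
    also have "\<dots> \<le> exp (- (K / (2 * P)) * (P - ?p)^2)^t / (2 * P - 1)"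
      using p P1 by (intro head_le assms(1)) auto
    also have "\<dots> \<le> ?\<theta>^t / (2 * P - 1)"
      using p P P1 K_pos by (intro divide_right_mono power_mono) (auto intro!: mult_left_mono power_mono divide_right_mono)
    finally show ?thesis .
  qed
  show ?thesis unfolding uniform_limit_iff dist_norm
  proof (intro allI impI)
    fix e :: real assume "e > 0"
    then have "\<forall>\<^sub>F t in sequentially. ?\<theta>^t / (2 * P - 1) < e"
      using lim by (intro order_tendstoD)
    then show "\<forall>\<^sub>F t in sequentially. \<forall>r\<in>{2<..r1}.
        norm (normalised_coef t r - complex_of_real (1 / sqrt (1 - 4 / r^2))) < e"
      by eventually_elim (meson le le_less_trans)
  qed
qed

end

section \<open>From fixed pairs to compact parameter sets\<close>

lemma compact_nat_imp_finite:
  fixes A :: "nat set"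
  assumes "compact A"
  shows "finite A"
proof (cases "A = {}")
  case False
  then obtain s where "\<forall>t\<in>A. t \<le> s" using compact_attains_sup[OF assms] by blast
  then show ?thesis by (meson finite_nat_set_iff_bounded_le)
qed simp

text \<open>The projection of a compact set to the discrete pairs \<open>(k1, k2)\<close> is finite,
  so uniform convergence on each compact slice suffices. Only nonempty slices occur, so an extremal
  \<open>r\<close> is available.\<close>

lemma uniform_limit_slices:
  fixes K :: "('a::t2_space \<times> nat \<times> nat) set"
  assumes "compact K"
    and slice: "\<And>k1 k2. compact {r. (r, k1, k2) \<in> K} \<Longrightarrow> {r. (r, k1, k2) \<in> K} \<noteq> {} \<Longrightarrow>
        uniform_limit {r. (r, k1, k2) \<in> K} (\<lambda>t r. f t (r, k1, k2)) (\<lambda>r. l (r, k1, k2)) F"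
  shows "uniform_limit K f l F"
proof -
  have "finite (fst ` snd ` K)" "finite (snd ` snd ` K)"
    by (intro compact_nat_imp_finite compact_continuous_image continuous_intros assms)+
  then have fin: "finite (snd ` K)"
    by (rule finite_subset[rotated, OF finite_cartesian_product]) force
  have compact_slice: "compact {r. (r, k1, k2) \<in> K}" for k1 k2
  proof -
    have "{r. (r, k1, k2) \<in> K} = fst ` (K \<inter> UNIV \<times> {(k1, k2)})" by force
    moreover have "closed (UNIV \<times> {(k1, k2)} :: ('a \<times> nat \<times> nat) set)"
      by (intro closed_Times) auto
    ultimately show ?thesis
      using assms(1) by (auto intro!: compact_continuous_image continuous_intros compact_Int_closed)
  qed
  show ?thesis unfolding uniform_limit_iff
  proof (intro allI impI)
    fix e :: real assume e: "e > 0"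
    have "\<forall>\<^sub>F t in F. \<forall>k\<in>snd ` K. \<forall>r\<in>{r. (r, k) \<in> K}. dist (f t (r, k)) (l (r, k)) < e"
    proof (rule eventually_ball_finite[OF fin], rule ballI)
      fix k assume "k \<in> snd ` K"
      then obtain r k1 k2 where k: "k = (k1, k2)" "(r, k1, k2) \<in> K" by force
      then have "uniform_limit {r. (r, k1, k2) \<in> K} (\<lambda>t r. f t (r, k1, k2)) (\<lambda>r. l (r, k1, k2)) F"
        by (intro slice compact_slice) auto
      then show "\<forall>\<^sub>F t in F. \<forall>r\<in>{r. (r, k) \<in> K}. dist (f t (r, k)) (l (r, k)) < e"
        using e by (simp add: uniform_limit_iff k(1))
    qed
    then show "\<forall>\<^sub>F t in F. \<forall>z\<in>K. dist (f t z) (l z) < e"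
      by eventually_elim force
  qed
qed

lemma ratio_eq_M:
  "split_weights k1 k2 \<Longrightarrow> (real k1 + real k2)^2 / (r^2 * real k1 * real k2) = split_weights.M k1 k2 / r^2"
  by (simp add: split_weights.M_def mult_ac)

theorem theorem4:
  shows
  "(\<forall>(r::real) (k1::nat) (k2::nat). r > 2 \<longrightarrow> 0 < k2 \<longrightarrow> k2 \<le> k1 \<longrightarrow>
     ((real k1 + real k2)^2 / (r^2 * real k1 * real k2) < 1 \<longrightarrow>
        ((\<lambda>t::nat. complex_of_real (sqrt (real t) *
            (r powr (real k1 + real k2) * real k1 ^ k1 * real k2 ^ k2
             / (real k1 + real k2) ^ (k1 + k2)) ^ t)
           * coef r (int (t * k1)) (int (t * k2)))
         \<longlonglongrightarrow> complex_of_real (1 / sqrt (2 * pi) * sqrt ((real k1 + real k2) / (real k1 * real k2))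
                * (1 / (1 - (real k1 + real k2)^2 / (r^2 * real k1 * real k2)))))) \<and>
     ((real k1 + real k2)^2 / (r^2 * real k1 * real k2) = 1 \<longrightarrow>
        ((\<lambda>t::nat. coef r (int (t * k1)) (int (t * k2))
            / complex_of_real ((r / 2 - sqrt (r^2 / 4 - 1)) ^ (t * (k1 - k2))))
         \<longlonglongrightarrow> complex_of_real (1 / (2 * sqrt (1 - 4 / r^2))))) \<and>
     ((real k1 + real k2)^2 / (r^2 * real k1 * real k2) > 1 \<longrightarrow>
        ((\<lambda>t::nat. coef r (int (t * k1)) (int (t * k2))
            / complex_of_real ((r / 2 - sqrt (r^2 / 4 - 1)) ^ (t * (k1 - k2))))
         \<longlonglongrightarrow> complex_of_real (1 / sqrt (1 - 4 / r^2)))))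
   \<and>
   (\<forall>K :: (real \<times> nat \<times> nat) set. compact K \<longrightarrow>
      K \<subseteq> {(r, k1, k2). r > 2 \<and> 0 < k2 \<and> k2 \<le> k1 \<and>
                 (real k1 + real k2)^2 / (r^2 * real k1 * real k2) < 1} \<longrightarrow>
      uniform_limit K
        (\<lambda>(t::nat) (r, k1, k2). complex_of_real (sqrt (real t) *
            (r powr (real k1 + real k2) * real k1 ^ k1 * real k2 ^ k2
             / (real k1 + real k2) ^ (k1 + k2)) ^ t)
           * coef r (int (t * k1)) (int (t * k2)))
        (\<lambda>(r, k1, k2). complex_of_real (1 / sqrt (2 * pi) * sqrt ((real k1 + real k2) / (real k1 * real k2))
                * (1 / (1 - (real k1 + real k2)^2 / (r^2 * real k1 * real k2)))))
        sequentially)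
   \<and>
   (\<forall>K :: (real \<times> nat \<times> nat) set. compact K \<longrightarrow>
      K \<subseteq> {(r, k1, k2). r > 2 \<and> 0 < k2 \<and> k2 \<le> k1 \<and>
                 (real k1 + real k2)^2 / (r^2 * real k1 * real k2) > 1} \<longrightarrow>
      uniform_limit K
        (\<lambda>(t::nat) (r, k1, k2). coef r (int (t * k1)) (int (t * k2))
            / complex_of_real ((r / 2 - sqrt (r^2 / 4 - 1)) ^ (t * (k1 - k2))))
        (\<lambda>(r, k1, k2). complex_of_real (1 / sqrt (1 - 4 / r^2)))
        sequentially)"
proof (intro conjI allI impI, goal_cases)
  case (1 r k1 k2)
  then interpret split_weights k1 k2 by unfold_locales auto
  note M = ratio_eq_M[OF split_weights_axioms]
  \<comment> \<open>The pointwise limit is read off at the left endpoint of the half-line of uniform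
    convergence.\<close>
  show ?case unfolding M
    by (rule tendsto_uniform_limitI[OF subcritical_uniform_limit[of r]]) (use 1 in \<open>auto simp: M\<close>)
next
  case (2 r k1 k2)
  then interpret split_weights k1 k2 by unfold_locales auto
  show ?case using critical_limit 2 by (simp add: ratio_eq_M[OF split_weights_axioms])
next
  case (3 r k1 k2)
  then interpret split_weights k1 k2 by unfold_locales auto
  note M = ratio_eq_M[OF split_weights_axioms]
  show ?case
    by (rule tendsto_uniform_limitI[OF supercritical_uniform_limit[of r]]) (use 3 in \<open>auto simp: M\<close>)
next
  case (4 K)
  show ?case
  proof (rule uniform_limit_slices[OF 4(1)], unfold prod.case)
    fix k1 k2
    let ?A = "{r. (r, k1, k2) \<in> K}"
    assume "compact ?A" "?A \<noteq> {}"
    \<comment> \<open>The smallest \<open>r\<close> of the slice has the largest quotient, so it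
      controls the error in case (i).\<close>
    then obtain r0 where r0: "r0 \<in> ?A" "\<forall>r\<in>?A. r0 \<le> r" using compact_attains_inf by blast
    with 4(2) have *: "r0 > 2" "0 < k2" "k2 \<le> k1"
      "(real k1 + real k2)^2 / (r0^2 * real k1 * real k2) < 1" by auto
    then interpret split_weights k1 k2 by unfold_locales auto
    note M = ratio_eq_M[OF split_weights_axioms]
    show "uniform_limit ?A scaled_coef (\<lambda>r. complex_of_real (1 / sqrt (2 * pi)
        * sqrt ((real k1 + real k2) / (real k1 * real k2))
        * (1 / (1 - (real k1 + real k2)^2 / (r^2 * real k1 * real k2))))) sequentially"
      unfolding M by (rule uniform_limit_on_subset[OF subcritical_uniform_limit[of r0]])
        (use * r0 in \<open>auto simp: M\<close>)
  qed
next
  case (5 K)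
  show ?case
  proof (rule uniform_limit_slices[OF 5(1)], unfold prod.case)
    fix k1 k2
    let ?A = "{r. (r, k1, k2) \<in> K}"
    assume "compact ?A" "?A \<noteq> {}"
    \<comment> \<open>Here the largest \<open>r\<close> is the worst: its quotient is closest to 1
      from above.\<close>
    then obtain r1 where r1: "r1 \<in> ?A" "\<forall>r\<in>?A. r \<le> r1" using compact_attains_sup by blast
    with 5(2) have *: "r1 > 2" "0 < k2" "k2 \<le> k1"
      "(real k1 + real k2)^2 / (r1^2 * real k1 * real k2) > 1" by auto
    then interpret split_weights k1 k2 by unfold_locales auto
    note M = ratio_eq_M[OF split_weights_axioms]
    show "uniform_limit ?A normalised_coef (\<lambda>r. complex_of_real (1 / sqrt (1 - 4 / r^2))) sequentially"
      by (rule uniform_limit_on_subset[OF supercritical_uniform_limit[of r1]])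
        (use * r1 5(2) in \<open>auto simp: M\<close>)
  qed
qed

end
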